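(* Let $n\ge 2$ be an integer and let $a$ be a real number with $0\le a<1$. Then $$ \frac{\mathrm{vol}(D^a\cap \hat{\mathfrak D}_n)}{\mathrm{vol}(\hat{\mathfrak D}_n)} =\frac{1}{(n-1)!}\sum_{(i,k)}(-1)^{n+i}\binom{n}{i}(k-ia)^{n-1}, $$ where the sum runs over all pairs of integers $(i,k)$ with $2\le i\le n$ and $\max(ia,\,i-n+1)\le k\le i-1$.
   Context: For an integer $n\ge 2$ put $$\hat{\mathfrak D}_n:=\Big\{(x_1,\dots,x_n)\in[0,1)^n \;\Big|\; 0\le x_1\le x_2\le\dots\le x_n<1,\ \sum_{i=1}^n x_i\in\mathbb Z\Big\},$$ and for $0\le a<1$ put $$D^a:=\{(x_1,\dots,x_n)\in[0,1)^n\mid a\le x_1\}.$$ The set $\hat{\mathfrak D}_n$ lies in the union of the finitely many parallel hyperplanes $\{x_1+\dots+x_n=k\}$, $k=0,1,\dots,n-1$, of $\mathbb R^n$. For a subset of $\hat{\mathfrak D}_n$, $\mathrm{vol}$ denotes its $(n-1)$-dimensional volume, i.e. the sum over $k$ of the $(n-1)$-dimensional Euclidean (Hausdorff) measures of its intersections with these hyperplanes. *)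

theory Defs
  imports "HOL-Analysis.Analysis"
begin

text \<open>
  Hausdorff measure of integer dimension \<open>m\<close> on a metric space with carrier \<open>M\<close> and distance
  \<open>d\<close>. Diameters are extended nonnegative reals, so sets of infinite diameter are allowed in
  coverings and weigh \<open>\<infinity>\<close> (for \<open>m > 0\<close>). The empty set weighs \<open>0\<close> also for \<open>m = 0\<close>, where
  \<open>0 ^ 0 = 1\<close>.
\<close>

definition ediameter :: "('a \<Rightarrow> 'a \<Rightarrow> real) \<Rightarrow> 'a set \<Rightarrow> ennreal" where
  "ediameter d U = (SUP (x, y)\<in>U \<times> U. ennreal (d x y))"

text \<open>
  The factor \<open>unit_ball_vol m / 2 ^ m\<close> is the volume of a Euclidean \<open>m\<close>-ball of diameter one; with
  it the Hausdorff measure agrees with \<open>m\<close>-dimensional Lebesgue measure on Euclidean \<open>m\<close>-space.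
\<close>

definition hausdorff_weight :: "('a \<Rightarrow> 'a \<Rightarrow> real) \<Rightarrow> nat \<Rightarrow> 'a set \<Rightarrow> ennreal" where
  "hausdorff_weight d m U =
     (if U = {} then 0 else ennreal (unit_ball_vol (real m) / 2 ^ m) * ediameter d U ^ m)"

definition hausdorff_content ::
  "'a set \<Rightarrow> ('a \<Rightarrow> 'a \<Rightarrow> real) \<Rightarrow> nat \<Rightarrow> real \<Rightarrow> 'a set \<Rightarrow> ennreal" where
  "hausdorff_content M d m \<delta> S =
     (INF U\<in>{U :: nat \<Rightarrow> 'a set.
        (\<forall>j. U j \<subseteq> M \<and> ediameter d (U j) \<le> ennreal \<delta>) \<and> S \<subseteq> (\<Union>j. U j)}.
        \<Sum>j. hausdorff_weight d m (U j))"

definition hausdorff_measure ::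
  "'a set \<Rightarrow> ('a \<Rightarrow> 'a \<Rightarrow> real) \<Rightarrow> nat \<Rightarrow> 'a set \<Rightarrow> ennreal" where
  "hausdorff_measure M d m S = (SUP \<delta>\<in>{0<..}. hausdorff_content M d m \<delta> S)"

text \<open>
  Points of Euclidean \<open>n\<close>-space are functions on the index set \<open>{1..n}\<close>, extended by \<open>undefined\<close>.
\<close>

definition euclid :: "nat \<Rightarrow> (nat \<Rightarrow> real) set" where
  "euclid n = {1..n} \<rightarrow>\<^sub>E UNIV"

definition euclid_dist :: "nat \<Rightarrow> (nat \<Rightarrow> real) \<Rightarrow> (nat \<Rightarrow> real) \<Rightarrow> real" where
  "euclid_dist n x y = L2_set (\<lambda>i. x i - y i) {1..n}"

lemma Metric_space_euclid: "Metric_space (euclid n) (euclid_dist n)"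
proof
  fix x y z
  show "0 \<le> euclid_dist n x y"
    by (simp add: euclid_dist_def L2_set_nonneg)
  show "euclid_dist n x y = euclid_dist n y x"
    by (simp add: euclid_dist_def L2_set_def power2_commute)
  show "euclid_dist n x y = 0 \<longleftrightarrow> x = y" if "x \<in> euclid n" "y \<in> euclid n"
    using that PiE_ext[of x "{1..n}" "\<lambda>_. UNIV" y]
    by (auto simp: euclid_dist_def euclid_def L2_set_eq_0_iff)
  show "euclid_dist n x z \<le> euclid_dist n x y + euclid_dist n y z"
    using L2_set_triangle_ineq[of "\<lambda>i. x i - y i" "\<lambda>i. y i - z i" "{1..n}"]
    by (simp add: euclid_dist_def)
qed

definition hyperplane :: "nat \<Rightarrow> nat \<Rightarrow> (nat \<Rightarrow> real) set" where
  "hyperplane n k = {x \<in> euclid n. (\<Sum>i=1..n. x i) = real k}"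

text \<open>
  Only meant for subsets of the union of the hyperplanes with \<open>k < n\<close>. Since \<^const>\<open>enn2real\<close> maps
  \<open>\<infinity>\<close> to \<open>0\<close>, the value is the volume only where the latter is finite, as it is for all subsets of
  the bounded set \<open>D_hat n\<close> below.
\<close>

definition vol :: "nat \<Rightarrow> (nat \<Rightarrow> real) set \<Rightarrow> real" where
  "vol n S =
     enn2real (\<Sum>k<n. hausdorff_measure (euclid n) (euclid_dist n) (n - 1) (S \<inter> hyperplane n k))"

definition D_hat :: "nat \<Rightarrow> (nat \<Rightarrow> real) set" where
  "D_hat n = {x \<in> {1..n} \<rightarrow>\<^sub>E {0..<1}. mono_on {1..n} x \<and> (\<Sum>i=1..n. x i) \<in> \<int>}"

definition D_ge :: "nat \<Rightarrow> real \<Rightarrow> (nat \<Rightarrow> real) set" where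
  "D_ge n a = {x \<in> {1..n} \<rightarrow>\<^sub>E {0..<1}. a \<le> x 1}"

end

theory Submission imports Defs begin

text \<open>
  Up to a null set of points with equal coordinates, the cube section
  \<open>{x | a \<le> x\<^sub>i < 1, x\<^sub>1 + \<dots> + x\<^sub>n = k}\<close> is the union of the \<open>n!\<close> images of its sorted part
  under permutations of the coordinates, and these images are disjoint and isometric. So the volume
  of \<open>D_ge n a \<inter> D_hat n\<close> is \<open>1 / n!\<close> times the total volume of the cube sections for
  \<open>k = 0, \<dots>, n - 1\<close>. On each hyperplane, the volume of a set is \<open>c\<close> times the Lebesgue measure of
  its projection along the last coordinate, with the same constant \<open>c\<close> for all \<open>k\<close>. It remains to find the Lebesgue measure of the
  projected section, \<open>{y \<in> [a,1)\<^sup>n\<^sup>-\<^sup>1 | k - \<Sum> y \<in> [a,1)}\<close>; as a function of \<open>k\<close>, taken as a real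
  variable, this is the density of the sum of \<open>n\<close> variables uniform on \<open>[a,1)\<close>, up to normalisation.
  Integrating out one variable at a time gives the classical alternating sum of truncated powers
  (Irwin and Hall), and summing over \<open>k\<close> and substituting \<open>i = n - j\<close> turns it into the formula of
  the theorem. For \<open>a = 0\<close> the projected sections tile \<open>[0,1)\<^sup>n\<^sup>-\<^sup>1\<close>, so the total is \<open>1\<close> and the
  volume of \<open>D_hat n\<close> is the common factor \<open>c / n!\<close>, which cancels in the quotient.

  What needs care is that volume here means Hausdorff measure. Only the ratio matters, so the value
  of \<open>c\<close> is irrelevant as long as \<open>0 < c < \<infinity>\<close>; the comparison of Hausdorff and Lebesgue measure with
  exact constants (the isodiametric inequality) is avoided. The steps are these. Hausdorff measure
  is additive on separated sets, hence by Caratheodory's criterion a measure on the product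
  sigma-algebra (\<open>hausdorff_sublevel_in_lambda_system\<close>, \<open>emeasure_surface_measure\<close>). Its restriction
  to a hyperplane, projected to the first \<open>n - 1\<close> coordinates, is translation invariant, finite on
  bounded sets (cover by a grid, \<open>hausdorff_over_cube_finite\<close>) and not zero (a set of diameter \<open>r\<close>
  projects into a box of side \<open>2 r\<close>, \<open>hausdorff_over_ge_lebesgue\<close>). A Fubini argument shows that such
  a measure is a multiple of Lebesgue measure (\<open>translation_invariant_eq_lebesgue\<close>). With
  \<open>hausdorff_cube_slice\<close> for the symmetrisation and \<open>cube_section_irwin_hall\<close> for the density, this
  proves the theorem.
\<close>

section \<open>Hausdorff measure as a metric outer measure\<close>

lemma ediameter_empty [simp]: "ediameter d {} = 0"
  by (simp add: ediameter_def bot_ennreal)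

lemma ediameter_upper: "x \<in> U \<Longrightarrow> y \<in> U \<Longrightarrow> ennreal (d x y) \<le> ediameter d U"
  unfolding ediameter_def by (rule SUP_upper2[of "(x, y)"]) auto

lemma ediameter_least:
  "(\<And>x y. x \<in> U \<Longrightarrow> y \<in> U \<Longrightarrow> ennreal (d x y) \<le> c) \<Longrightarrow> ediameter d U \<le> c"
  unfolding ediameter_def by (rule SUP_least) auto

lemma hausdorff_weight_empty [simp]: "hausdorff_weight d m {} = 0"
  by (simp add: hausdorff_weight_def)

lemma hausdorff_weight_mono:
  "V = {} \<or> U \<noteq> {} \<and> ediameter d' V \<le> ediameter d U
    \<Longrightarrow> hausdorff_weight d' m V \<le> hausdorff_weight d m U"
  by (auto simp: hausdorff_weight_def intro!: mult_left_mono power_mono)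

lemma hausdorff_content_le:
  assumes "\<And>j. U j \<subseteq> M" "\<And>j. ediameter d (U j) \<le> ennreal \<delta>" "S \<subseteq> (\<Union>j::nat. U j)"
  shows "hausdorff_content M d m \<delta> S \<le> (\<Sum>j. hausdorff_weight d m (U j))"
  unfolding hausdorff_content_def using assms by (intro INF_lower) auto

lemma hausdorff_content_greatest:
  assumes "\<And>U. (\<And>j. U j \<subseteq> M) \<Longrightarrow> (\<And>j. ediameter d (U j) \<le> ennreal \<delta>) \<Longrightarrow> S \<subseteq> (\<Union>j::nat. U j)
    \<Longrightarrow> c \<le> (\<Sum>j. hausdorff_weight d m (U j))"
  shows "c \<le> hausdorff_content M d m \<delta> S"
  unfolding hausdorff_content_def using assms by (intro INF_greatest) auto

lemma hausdorff_content_approx: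
  assumes "hausdorff_content M d m \<delta> S < c"
  obtains U :: "nat \<Rightarrow> 'a set" where "\<And>j. U j \<subseteq> M" "\<And>j. ediameter d (U j) \<le> ennreal \<delta>"
    "S \<subseteq> (\<Union>j. U j)" "(\<Sum>j. hausdorff_weight d m (U j)) < c"
  using assms unfolding hausdorff_content_def INF_less_iff by blast

lemma hausdorff_content_mono:
  "S \<subseteq> T \<Longrightarrow> hausdorff_content M d m \<delta> S \<le> hausdorff_content M d m \<delta> T"
  by (rule hausdorff_content_greatest) (auto intro!: hausdorff_content_le)

lemma hausdorff_content_antimono:
  "\<delta> \<le> \<epsilon> \<Longrightarrow> hausdorff_content M d m \<epsilon> S \<le> hausdorff_content M d m \<delta> S"
  by (intro hausdorff_content_greatest hausdorff_content_le) (blast intro: order_trans ennreal_leI)+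

lemma hausdorff_content_empty: "hausdorff_content M d m \<delta> {} = 0"
  using hausdorff_content_le[of "\<lambda>_. {}" M d \<delta> "{}" m] by simp

text \<open>
  Countable subadditivity, by the usual choice of coverings that are optimal up to \<open>e / 2\<^sup>i\<^sup>+\<^sup>1\<close> for
  the \<open>i\<close>-th set, merged into one sequence by the pairing function on the natural numbers.
\<close>
lemma hausdorff_content_UN:
  "hausdorff_content M d m \<delta> (\<Union>i. A i) \<le> (\<Sum>i. hausdorff_content M d m \<delta> (A i))"
proof (rule ennreal_le_epsilon)
  fix e :: real
  assume fin: "(\<Sum>i. hausdorff_content M d m \<delta> (A i)) < top" and e: "0 < e"
  have "\<exists>U :: nat \<Rightarrow> _. (\<forall>j. U j \<subseteq> M) \<and> (\<forall>j. ediameter d (U j) \<le> ennreal \<delta>) \<and> A i \<subseteq> (\<Union>j. U j) \<and>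
    (\<Sum>j. hausdorff_weight d m (U j))
        \<le> hausdorff_content M d m \<delta> (A i) + ennreal (e * (1/2) ^ Suc i)" for i
  proof -
    have "hausdorff_content M d m \<delta> (A i) \<noteq> top"
      using ennreal_suminf_lessD[OF fin, of i] by simp
    then have "hausdorff_content M d m \<delta> (A i)
        < hausdorff_content M d m \<delta> (A i) + ennreal (e * (1/2) ^ Suc i)"
      using e by (simp add: ennreal_add_left_cancel_less less_top)
    from hausdorff_content_approx[OF this] show ?thesis
      by (metis less_imp_le)
  qed
  then obtain U :: "nat \<Rightarrow> nat \<Rightarrow> _" where U: "\<And>i j. U i j \<subseteq> M"
      "\<And>i j. ediameter d (U i j) \<le> ennreal \<delta>" "\<And>i. A i \<subseteq> (\<Union>j. U i j)"
      "\<And>i. (\<Sum>j. hausdorff_weight d m (U i j))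
        \<le> hausdorff_content M d m \<delta> (A i) + ennreal (e * (1/2) ^ Suc i)"
    by metis
  define V where "V k = case_prod U (prod_decode k)" for k
  have "(\<Union>i. A i) \<subseteq> (\<Union>k. V k)"
  proof
    fix x assume "x \<in> (\<Union>i. A i)"
    then obtain i j where "x \<in> U i j" using U(3) by fast
    then have "x \<in> V (prod_encode (i, j))" by (simp add: V_def)
    then show "x \<in> (\<Union>k. V k)" by blast
  qed
  then have "hausdorff_content M d m \<delta> (\<Union>i. A i) \<le> (\<Sum>k. hausdorff_weight d m (V k))"
    using U(1,2) by (intro hausdorff_content_le) (auto simp: V_def split: prod.split)
  also have "\<dots> = (\<Sum>i. \<Sum>j. hausdorff_weight d m (U i j))"
    using suminf_ennreal_2dimen[of "\<lambda>i. \<Sum>j. hausdorff_weight d m (U i j)"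
        "\<lambda>p. hausdorff_weight d m (case_prod U p)"]
    by (simp add: V_def)
  also have "\<dots> \<le> (\<Sum>i. hausdorff_content M d m \<delta> (A i) + ennreal (e * (1/2) ^ Suc i))"
    by (intro suminf_le U(4)) auto
  also have "\<dots> = (\<Sum>i. hausdorff_content M d m \<delta> (A i)) + (\<Sum>i. ennreal (e * (1/2) ^ Suc i))"
    by (rule suminf_add[symmetric]) auto
  also have "(\<Sum>i. ennreal (e * (1/2) ^ Suc i)) = ennreal (e * 1)"
    using e sums_mult[OF power_half_series, of e] by (intro suminf_ennreal_eq) auto
  finally show "hausdorff_content M d m \<delta> (\<Union>i. A i)
      \<le> (\<Sum>i. hausdorff_content M d m \<delta> (A i)) + ennreal e" by simp
qed

lemma hausdorff_content_le_measure:
  "0 < \<delta> \<Longrightarrow> hausdorff_content M d m \<delta> S \<le> hausdorff_measure M d m S"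
  unfolding hausdorff_measure_def by (rule SUP_upper) simp

lemma hausdorff_measure_empty [simp]: "hausdorff_measure M d m {} = 0"
  unfolding hausdorff_measure_def by (simp add: hausdorff_content_empty)

lemma hausdorff_measure_mono:
  "S \<subseteq> T \<Longrightarrow> hausdorff_measure M d m S \<le> hausdorff_measure M d m T"
  unfolding hausdorff_measure_def by (intro SUP_mono' hausdorff_content_mono)

lemma hausdorff_measure_UN:
  "hausdorff_measure M d m (\<Union>i. A i) \<le> (\<Sum>i. hausdorff_measure M d m (A i))"
  unfolding hausdorff_measure_def[of M d m "\<Union>i. A i"]
proof (rule SUP_least)
  fix \<delta> :: real assume "\<delta> \<in> {0<..}"
  then have "(\<Sum>i. hausdorff_content M d m \<delta> (A i)) \<le> (\<Sum>i. hausdorff_measure M d m (A i))"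
    by (intro suminf_le hausdorff_content_le_measure) auto
  with hausdorff_content_UN
  show "hausdorff_content M d m \<delta> (\<Union>i. A i) \<le> (\<Sum>i. hausdorff_measure M d m (A i))"
    by (rule order_trans)
qed

lemma outer_measure_space_hausdorff:
  "outer_measure_space (Pow M) (hausdorff_measure M d m)"
  by (auto simp: outer_measure_space_def positive_def increasing_def countably_subadditive_def
      intro: hausdorff_measure_mono hausdorff_measure_UN)

lemma hausdorff_measure_Un:
  "hausdorff_measure M d m (A \<union> B) \<le> hausdorff_measure M d m A + hausdorff_measure M d m B"
proof -
  have "(\<Union>i. binaryset A B i) = A \<union> B" by (rule UN_binaryset_eq)
  moreover have "(\<Sum>i. hausdorff_measure M d m (binaryset A B i))
      = hausdorff_measure M d m A + hausdorff_measure M d m B"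
    by (rule suminf_binaryset_eq) simp
  ultimately show ?thesis using hausdorff_measure_UN[of M d m "binaryset A B"] by simp
qed

text \<open>
  A covering set of diameter below \<open>\<epsilon>\<close> cannot meet both \<open>A\<close> and \<open>B\<close>, so every fine covering of
  \<open>A \<union> B\<close> splits into a covering of \<open>A\<close> and one of \<open>B\<close>. Together with subadditivity this makes
  Hausdorff measure a metric outer measure.
\<close>
lemma hausdorff_measure_separated:
  assumes \<epsilon>: "0 < \<epsilon>" and sep: "\<And>x y. x \<in> A \<Longrightarrow> y \<in> B \<Longrightarrow> \<epsilon> \<le> d x y"
  shows "hausdorff_measure M d m A + hausdorff_measure M d m B \<le> hausdorff_measure M d m (A \<union> B)"
proof -
  have small: "hausdorff_content M d m \<delta> A + hausdorff_content M d m \<delta> B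
      \<le> hausdorff_content M d m \<delta> (A \<union> B)" if \<delta>: "\<delta> < \<epsilon>" for \<delta>
  proof (rule hausdorff_content_greatest)
    fix U :: "nat \<Rightarrow> _"
    assume U: "\<And>j. U j \<subseteq> M" "\<And>j. ediameter d (U j) \<le> ennreal \<delta>" "A \<union> B \<subseteq> (\<Union>j. U j)"
    define V where "V C j = (if U j \<inter> C = {} then {} else U j)" for C j
    have V: "V C j \<subseteq> M" "ediameter d (V C j) \<le> ennreal \<delta>" for C j
      using U by (auto simp: V_def)
    have one: "hausdorff_weight d m (V A j) + hausdorff_weight d m (V B j)
        \<le> hausdorff_weight d m (U j)" for j
    proof -
      have "U j \<inter> A = {} \<or> U j \<inter> B = {}"
      proof (rule ccontr)
        assume "\<not> ?thesis"
        then obtain x y where xy: "x \<in> U j" "x \<in> A" "y \<in> U j" "y \<in> B" by auto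
        have "ennreal (d x y) \<le> ennreal \<delta>"
          using ediameter_upper[OF xy(1,3), of d] U(2)[of j] by (rule order_trans)
        then have "d x y \<le> \<delta>" using sep[OF xy(2,4)] \<epsilon>
          by (simp add: ennreal_le_iff2)
        then show False using sep[OF xy(2,4)] \<delta> by linarith
      qed
      then show ?thesis by (auto simp: V_def)
    qed
    have "hausdorff_content M d m \<delta> C \<le> (\<Sum>j. hausdorff_weight d m (V C j))"
      if "C \<subseteq> A \<union> B" for C
    proof (rule hausdorff_content_le[OF V])
      show "C \<subseteq> (\<Union>j. V C j)"
      proof
        fix x assume x: "x \<in> C"
        then obtain j where "x \<in> U j" using \<open>C \<subseteq> A \<union> B\<close> U(3) by blast
        then have "x \<in> V C j" using x by (auto simp: V_def)
        then show "x \<in> (\<Union>j. V C j)" by blast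
      qed
    qed
    from add_mono[OF this[of A] this[of B]]
    have "hausdorff_content M d m \<delta> A + hausdorff_content M d m \<delta> B
        \<le> (\<Sum>j. hausdorff_weight d m (V A j)) + (\<Sum>j. hausdorff_weight d m (V B j))"
      by simp
    also have "\<dots> = (\<Sum>j. hausdorff_weight d m (V A j) + hausdorff_weight d m (V B j))"
      by (rule suminf_add) auto
    also have "\<dots> \<le> (\<Sum>j. hausdorff_weight d m (U j))"
      by (intro suminf_le one) auto
    finally show "hausdorff_content M d m \<delta> A + hausdorff_content M d m \<delta> B
        \<le> (\<Sum>j. hausdorff_weight d m (U j))" .
  qed
  \<comment> \<open>The suprema over \<open>\<delta>\<close> for \<open>A\<close> and \<open>B\<close> are independent; contents grow as \<open>\<delta>\<close> shrinks, so a common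
    small \<open>\<delta>\<close> serves for both.\<close>
  have bound: "hausdorff_content M d m \<alpha> A + hausdorff_content M d m \<beta> B
      \<le> hausdorff_measure M d m (A \<union> B)" if "\<alpha> > 0" "\<beta> > 0" for \<alpha> \<beta>
  proof -
    define \<delta> where "\<delta> = min (\<epsilon> / 2) (min \<alpha> \<beta>)"
    have \<delta>: "0 < \<delta>" "\<delta> < \<epsilon>" "\<delta> \<le> \<alpha>" "\<delta> \<le> \<beta>" using that \<epsilon> by (auto simp: \<delta>_def)
    have "hausdorff_content M d m \<alpha> A + hausdorff_content M d m \<beta> B
        \<le> hausdorff_content M d m \<delta> A + hausdorff_content M d m \<delta> B"
      using \<delta> by (intro add_mono hausdorff_content_antimono)
    also have "\<dots> \<le> hausdorff_content M d m \<delta> (A \<union> B)" by (rule small) fact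
    also have "\<dots> \<le> hausdorff_measure M d m (A \<union> B)" using \<delta> by (intro hausdorff_content_le_measure)
    finally show ?thesis .
  qed
  have "hausdorff_content M d m \<alpha> A + hausdorff_measure M d m B
      \<le> hausdorff_measure M d m (A \<union> B)" if "\<alpha> > 0" for \<alpha>
    unfolding hausdorff_measure_def[of M d m B] using that bound
    by (subst ennreal_SUP_add_right) (auto intro!: SUP_least)
  then show ?thesis
    unfolding hausdorff_measure_def[of M d m A]
    by (subst ennreal_SUP_add_left[symmetric]) (auto intro!: SUP_least)
qed

lemma hausdorff_measure_image_le:
  assumes T: "T \<in> M \<rightarrow> M'" and d: "\<And>x y. x \<in> M \<Longrightarrow> y \<in> M \<Longrightarrow> d' (T x) (T y) \<le> d x y"
    and S: "S \<subseteq> M"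
  shows "hausdorff_measure M' d' m (T ` S) \<le> hausdorff_measure M d m S"
proof -
  have *: "ediameter d' (T ` U) \<le> ediameter d U" if "U \<subseteq> M" for U
  proof (rule ediameter_least, clarify)
    fix x y assume xy: "x \<in> U" "y \<in> U"
    then have "ennreal (d' (T x) (T y)) \<le> ennreal (d x y)"
      using that by (intro ennreal_leI d) auto
    also have "\<dots> \<le> ediameter d U" using xy by (rule ediameter_upper)
    finally show "ennreal (d' (T x) (T y)) \<le> ediameter d U" .
  qed
  have "hausdorff_content M' d' m \<delta> (T ` S) \<le> hausdorff_content M d m \<delta> S" for \<delta>
  proof (rule hausdorff_content_greatest)
    fix U :: "nat \<Rightarrow> _"
    assume U: "\<And>j. U j \<subseteq> M" "\<And>j. ediameter d (U j) \<le> ennreal \<delta>" "S \<subseteq> (\<Union>j. U j)"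
    have "hausdorff_content M' d' m \<delta> (T ` S) \<le> (\<Sum>j. hausdorff_weight d' m (T ` U j))"
    proof (rule hausdorff_content_le)
      show "T ` U j \<subseteq> M'" for j using U(1)[of j] T by blast
      show "ediameter d' (T ` U j) \<le> ennreal \<delta>" for j
        using *[OF U(1)] U(2) by (rule order_trans)
      show "T ` S \<subseteq> (\<Union>j. T ` U j)" using U(3) by blast
    qed
    also have "\<dots> \<le> (\<Sum>j. hausdorff_weight d m (U j))"
      using *[OF U(1)] by (intro suminf_le hausdorff_weight_mono) auto
    finally show "hausdorff_content M' d' m \<delta> (T ` S) \<le> (\<Sum>j. hausdorff_weight d m (U j))" .
  qed
  then show ?thesis unfolding hausdorff_measure_def by (rule SUP_mono')
qed

text \<open>
  Caratheodory's criterion for metric outer measures, for sublevel sets of a 1-Lipschitz function.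
  The part \<open>B k\<close> of \<open>A\<close> where \<open>f \<ge> c + 1 / (k + 1)\<close> is separated from the sublevel set, so additivity
  holds for it. The rest of \<open>A\<close> above level \<open>c\<close> is a union of shells \<open>R j\<close>, \<open>j \<ge> k\<close>. Shells whose
  indices differ by at least two are separated from each other, so the shells of even index, and
  likewise those of odd index, have total measure at most that of \<open>A\<close>. Hence the sum over all shells
  converges, and the remainder is negligible as \<open>k\<close> grows.
\<close>
lemma hausdorff_sublevel_in_lambda_system:
  assumes lip: "\<And>x y. x \<in> M \<Longrightarrow> y \<in> M \<Longrightarrow> \<bar>f x - f y\<bar> \<le> d x y"
  shows "{x \<in> M. f x \<le> (c::real)} \<in> lambda_system M (Pow M) (hausdorff_measure M d m)"
proof -
  let ?H = "hausdorff_measure M d m"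
  have sep: "?H (A \<union> B) \<ge> ?H A + ?H B" if "A \<subseteq> M" "B \<subseteq> M" "s < t"
    "\<And>x. x \<in> A \<Longrightarrow> f x \<le> s" "\<And>x. x \<in> B \<Longrightarrow> t \<le> f x" for A B s t
  proof (rule hausdorff_measure_separated)
    show "0 < t - s" using that by simp
    fix x y assume "x \<in> A" "y \<in> B"
    then show "t - s \<le> d x y" using that lip[of x y] by fastforce
  qed
  have main: "?H (A \<inter> {x \<in> M. f x \<le> c}) + ?H (A - {x \<in> M. f x \<le> c}) \<le> ?H A"
    if A: "A \<subseteq> M" and fin: "?H A \<noteq> top" for A
  proof -
    define B where "B k = {x \<in> A. f x \<ge> c + 1 / real (Suc k)}" for k
    define R where "R k = B (Suc k) - B k" for k
    have le: "1 / real (Suc l) \<le> 1 / real (Suc k)" if "k \<le> l" for k l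
      using that by (simp add: frac_le)
    have BR: "A - {x \<in> M. f x \<le> c} = B k \<union> (\<Union>j. R (j + k))" for k
    proof
      show "A - {x \<in> M. f x \<le> c} \<subseteq> B k \<union> (\<Union>j. R (j + k))"
      proof
        fix x assume "x \<in> A - {x \<in> M. f x \<le> c}"
        then have x: "x \<in> A" "c < f x" using A by auto
        obtain N where N: "1 / real (Suc N) < f x - c"
          using x reals_Archimedean[of "f x - c"] by (auto simp: inverse_eq_divide)
        have "x \<in> B (max N k)" using x N le[of N "max N k"] by (auto simp: B_def)
        then have ex: "\<exists>j. x \<in> B (j + k)"
          by (intro exI[of _ "max N k - k"]) simp
        define j where "j = (LEAST j. x \<in> B (j + k))"
        have j: "x \<in> B (j + k)" unfolding j_def using ex by (rule LeastI_ex)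
        show "x \<in> B k \<union> (\<Union>j. R (j + k))"
        proof (cases j)
          case 0
          then show ?thesis using j by simp
        next
          case (Suc i)
          then have "x \<notin> B (i + k)"
            using not_less_Least[of i "\<lambda>j. x \<in> B (j + k)"] by (simp add: j_def)
          then have "x \<in> R (i + k)" using j Suc by (simp add: R_def)
          then show ?thesis by blast
        qed
      qed
    next
      have "B l \<subseteq> A - {x \<in> M. f x \<le> c}" for l
      proof
        fix x assume x: "x \<in> B l"
        have "c < c + 1 / real (Suc l)" by simp
        also have "\<dots> \<le> f x" using x by (simp add: B_def)
        finally show "x \<in> A - {x \<in> M. f x \<le> c}" using x by (simp add: B_def)
      qed
      then show "B k \<union> (\<Union>j. R (j + k)) \<subseteq> A - {x \<in> M. f x \<le> c}"
        unfolding R_def by blast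
    qed
    have alt: "(\<Sum>j<N. ?H (R (2 * j + p))) \<le> ?H (\<Union>j<N. R (2 * j + p))" for N p
    proof (induction N)
      case (Suc N)
      \<comment> \<open>\<open>f < c + 1 / (2 N + p + 1)\<close> on the new shell and \<open>f \<ge> c + 1 / (2 N + p)\<close> on the old ones; the level
        \<open>?t\<close> lies between, and the summand \<open>1 / 2\<close> keeps its denominator positive for \<open>N = p = 0\<close>.\<close>
      let ?t = "c + 1 / (real (2 * N + p) + 1 / 2)"
      have "?H (R (2 * N + p)) + ?H (\<Union>j<N. R (2 * j + p))
          \<le> ?H (R (2 * N + p) \<union> (\<Union>j<N. R (2 * j + p)))"
      proof (rule sep)
        show "c + 1 / real (Suc (2 * N + p)) < ?t"
          by (intro add_strict_left_mono divide_strict_left_mono) auto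
        show "f x \<le> c + 1 / real (Suc (2 * N + p))" if "x \<in> R (2 * N + p)" for x
          using that by (auto simp: R_def B_def)
        show "?t \<le> f x" if x: "x \<in> (\<Union>j<N. R (2 * j + p))" for x
        proof -
          from x obtain j where j: "j < N" "x \<in> R (2 * j + p)" by auto
          then have "?t \<le> c + 1 / real (Suc (Suc (2 * j + p)))"
            by (intro add_left_mono divide_left_mono) auto
          also have "\<dots> \<le> f x" using j by (auto simp: R_def B_def)
          finally show ?thesis .
        qed
      qed (use A in \<open>auto simp: R_def B_def\<close>)
      moreover have "(\<Union>j<Suc N. R (2 * j + p)) = R (2 * N + p) \<union> (\<Union>j<N. R (2 * j + p))"
        by (auto simp: lessThan_Suc)
      ultimately have "?H (R (2 * N + p)) + ?H (\<Union>j<N. R (2 * j + p))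
          \<le> ?H (\<Union>j<Suc N. R (2 * j + p))" by simp
      then have "?H (R (2 * N + p)) + (\<Sum>j<N. ?H (R (2 * j + p)))
          \<le> ?H (\<Union>j<Suc N. R (2 * j + p))"
        by (rule order_trans[OF add_left_mono[OF Suc.IH]])
      then show ?case unfolding sum.lessThan_Suc by (subst add.commute)
    qed simp
    have tot: "(\<Sum>j. ?H (R j)) \<noteq> top"
    proof -
      have "(\<Sum>j<N. ?H (R j)) \<le> 2 * ?H A" for N
      proof -
        have "(\<Sum>j<N. ?H (R j)) \<le> (\<Sum>j<2 * N. ?H (R j))" by (intro sum_mono2) auto
        also have "\<dots> = (\<Sum>j<N. ?H (R (2 * j + 0))) + (\<Sum>j<N. ?H (R (2 * j + 1)))"
          by (induction N) (auto simp: algebra_simps)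
        also have "\<dots> \<le> ?H A + ?H A"
          by (intro add_mono order_trans[OF alt] hausdorff_measure_mono) (auto simp: R_def B_def)
        finally show ?thesis by (simp add: mult_2)
      qed
      then have "(\<Sum>j. ?H (R j)) \<le> 2 * ?H A" by (intro suminf_le_const) auto
      also have "\<dots> < top" using fin by (simp add: ennreal_mult_less_top less_top)
      finally show ?thesis by simp
    qed
    have "?H (A \<inter> {x \<in> M. f x \<le> c}) + ?H (A - {x \<in> M. f x \<le> c})
        \<le> ?H A + (\<Sum>j. ?H (R (j + k)))" for k
    proof -
      have "?H (A - {x \<in> M. f x \<le> c}) \<le> ?H (B k) + ?H (\<Union>j. R (j + k))"
        unfolding BR[of k] by (rule hausdorff_measure_Un)
      also have "\<dots> \<le> ?H (B k) + (\<Sum>j. ?H (R (j + k)))"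
        by (intro add_left_mono hausdorff_measure_UN)
      finally have "?H (A \<inter> {x \<in> M. f x \<le> c}) + ?H (A - {x \<in> M. f x \<le> c})
          \<le> (?H (A \<inter> {x \<in> M. f x \<le> c}) + ?H (B k)) + (\<Sum>j. ?H (R (j + k)))"
        by (simp add: add.assoc add_left_mono)
      also have "?H (A \<inter> {x \<in> M. f x \<le> c}) + ?H (B k) \<le> ?H (A \<inter> {x \<in> M. f x \<le> c} \<union> B k)"
        using A by (intro sep[where s = c and t = "c + 1 / real (Suc k)"]) (auto simp: B_def)
      also have "\<dots> \<le> ?H A" by (intro hausdorff_measure_mono) (auto simp: B_def)
      finally show ?thesis by (simp add: add_right_mono)
    qed
    moreover have "(\<lambda>k. ?H A + (\<Sum>j. ?H (R (j + k)))) \<longlonglongrightarrow> ?H A + 0"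
    proof (rule tendsto_add[OF tendsto_const])
      let ?S = "\<lambda>k. \<Sum>j<k. ?H (R j)"
      have "(\<lambda>k. (\<Sum>j. ?H (R j)) - ?S k) \<longlonglongrightarrow> (\<Sum>j. ?H (R j)) - (\<Sum>j. ?H (R j))"
        using tot by (intro tendsto_diff_ennreal summable_LIMSEQ tendsto_const) auto
      moreover have "(\<Sum>j. ?H (R j)) - ?S k = (\<Sum>j. ?H (R (j + k)))" for k
      proof -
        have "(\<Sum>j. ?H (R j)) = (\<Sum>j. ?H (R (j + k))) + ?S k"
          by (rule suminf_offset) simp
        moreover from this tot have "?S k \<noteq> top" by auto
        ultimately show ?thesis by (simp add: ennreal_add_diff_cancel_right)
      qed
      ultimately show "(\<lambda>k. \<Sum>j. ?H (R (j + k))) \<longlonglongrightarrow> 0"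
        using tot by simp
    qed
    ultimately show ?thesis
      by (intro Lim_bounded2[of _ "?H A"]) auto
  qed
  have "?H (A \<inter> {x \<in> M. f x \<le> c}) + ?H (A - {x \<in> M. f x \<le> c}) = ?H A" if "A \<subseteq> M" for A
  proof (rule antisym)
    show "?H (A \<inter> {x \<in> M. f x \<le> c}) + ?H (A - {x \<in> M. f x \<le> c}) \<le> ?H A"
      using main[OF that] by (cases "?H A = top") auto
    show "?H A \<le> ?H (A \<inter> {x \<in> M. f x \<le> c}) + ?H (A - {x \<in> M. f x \<le> c})"
      using hausdorff_measure_Un[of M d m "A \<inter> {x \<in> M. f x \<le> c}" "A - {x \<in> M. f x \<le> c}"]
      by (simp add: Int_Diff_Un)
  qed
  then show ?thesis
    by (auto simp: algebra.lambda_system_eq algebra_Pow)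
qed

section \<open>Hausdorff measure on Euclidean space and its isometries\<close>

(* Index sets stay in the form {1..n}. *)
declare One_nat_def [simp del]

abbreviation lebesgue_cartesian :: "nat \<Rightarrow> (nat \<Rightarrow> real) measure" where
  "lebesgue_cartesian n \<equiv> Pi\<^sub>M {1..n} (\<lambda>_. lborel)"

interpretation lborel_product: product_sigma_finite "\<lambda>_::nat. lborel :: real measure"
  by standard

lemma space_lebesgue_cartesian [simp]: "space (lebesgue_cartesian n) = euclid n"
  by (simp add: space_PiM euclid_def)

lemma sigma_finite_lebesgue_cartesian: "sigma_finite_measure (lebesgue_cartesian n)"
  by (rule lborel_product.sigma_finite) simp

lemma coord_dist_le: "i \<in> {1..n} \<Longrightarrow> \<bar>x i - y i\<bar> \<le> euclid_dist n x y"
  using member_le_L2_set[of "{1..n}" i "\<lambda>i. x i - y i"]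
    member_le_L2_set[of "{1..n}" i "\<lambda>i. y i - x i"]
  by (auto simp: euclid_dist_def L2_set_def power2_commute abs_le_iff)

abbreviation hausdorff_codim1 :: "nat \<Rightarrow> (nat \<Rightarrow> real) set \<Rightarrow> ennreal" where
  "hausdorff_codim1 n \<equiv> hausdorff_measure (euclid n) (euclid_dist n) (n - 1)"

text \<open>
  The Hausdorff measure as a measure on the product sigma-algebra of \<open>{1..n}\<close>-indexed points, so that
  the measure-theoretic library applies to it.
\<close>
definition surface_measure :: "nat \<Rightarrow> (nat \<Rightarrow> real) measure" where
  "surface_measure n = measure_of (euclid n) (sets (lebesgue_cartesian n)) (hausdorff_codim1 n)"

lemma space_surface_measure [simp]: "space (surface_measure n) = euclid n"
  using sets.space_closed[of "lebesgue_cartesian n"]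
  by (simp add: surface_measure_def space_measure_of)

lemma sets_surface_measure [simp, measurable_cong]:
  "sets (surface_measure n) = sets (lebesgue_cartesian n)"
  using sets.space_closed[of "lebesgue_cartesian n"]
    sets.sigma_sets_eq[of "lebesgue_cartesian n"]
  by (simp add: surface_measure_def)

text \<open>
  The Caratheodory-measurable sets form a sigma-algebra on which Hausdorff measure is countably
  additive. Coordinates are 1-Lipschitz, so this sigma-algebra makes all of them measurable and
  contains the product sigma-algebra.
\<close>
lemma emeasure_surface_measure:
  assumes "A \<in> sets (lebesgue_cartesian n)"
  shows "emeasure (surface_measure n) A = hausdorff_codim1 n A"
proof -
  let ?M = "euclid n" and ?H = "hausdorff_codim1 n"
  let ?L = "lambda_system ?M (Pow ?M) ?H"
  have ms: "measure_space ?M ?L ?H"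
    by (rule sigma_algebra.caratheodory_lemma[OF sigma_algebra_Pow outer_measure_space_hausdorff])
  then have sa: "sigma_algebra ?M ?L" by (simp add: measure_space_def)
  define N where "N = sigma ?M ?L"
  have "?L \<subseteq> Pow ?M" by (auto dest: lambda_system_sets)
  then have N: "space N = ?M" "sets N = ?L"
    using sigma_algebra.sigma_sets_eq[OF sa] by (simp_all add: N_def)
  have "(\<lambda>x. x i) \<in> borel_measurable N" if "i \<in> {1..n}" for i
    unfolding borel_measurable_iff_le N using that
    by (auto intro!: hausdorff_sublevel_in_lambda_system coord_dist_le)
  then have "(\<lambda>x i. x i) \<in> measurable N (lebesgue_cartesian n)"
    by (intro measurable_PiM_single') (simp_all add: N, auto simp: euclid_def)
  then have sub: "sets (lebesgue_cartesian n) \<subseteq> ?L"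
    using measurable_sets[of "\<lambda>x. x" N "lebesgue_cartesian n"]
      sets.sets_into_space[of _ "lebesgue_cartesian n"]
    by (auto simp: N Int_absorb2)
  show ?thesis unfolding surface_measure_def
  proof (rule emeasure_measure_of_sigma)
    show "sigma_algebra ?M (sets (lebesgue_cartesian n))"
      using sets.sigma_algebra_axioms[of "lebesgue_cartesian n"] by simp
    show "positive (sets (lebesgue_cartesian n)) ?H" by (simp add: positive_def)
    show "countably_additive (sets (lebesgue_cartesian n)) ?H"
      using ms sub unfolding measure_space_def countably_additive_def by blast
  qed fact
qed

lemma hausdorff_measure_isometry:
  assumes T: "T \<in> M \<rightarrow> M" "\<And>x y. x \<in> M \<Longrightarrow> y \<in> M \<Longrightarrow> d (T x) (T y) = d x y"
    and T': "T' \<in> M \<rightarrow> M" "\<And>x. x \<in> M \<Longrightarrow> T' (T x) = x" "\<And>x. x \<in> M \<Longrightarrow> T (T' x) = x"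
    and S: "S \<subseteq> M"
  shows "hausdorff_measure M d m (T ` S) = hausdorff_measure M d m S"
proof (rule antisym)
  show "hausdorff_measure M d m (T ` S) \<le> hausdorff_measure M d m S"
    using T S by (intro hausdorff_measure_image_le) auto
  have "T' ` T ` S = S" using T' S by (force simp: image_image)
  moreover have "d (T' x) (T' y) = d x y" if "x \<in> M" "y \<in> M" for x y
    using T(2)[of "T' x" "T' y"] T'(1,3) that by (simp add: Pi_iff)
  moreover have "T ` S \<subseteq> M" using T(1) S by auto
  ultimately show "hausdorff_measure M d m S \<le> hausdorff_measure M d m (T ` S)"
    using hausdorff_measure_image_le[of T' M M d d "T ` S" m] T'(1) by simp
qed

definition translate :: "nat \<Rightarrow> (nat \<Rightarrow> real) \<Rightarrow> (nat \<Rightarrow> real) \<Rightarrow> nat \<Rightarrow> real" where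
  "translate n v x = (\<lambda>i\<in>{1..n}. x i + v i)"

lemma translate_in_euclid [simp]: "translate n v x \<in> euclid n"
  by (simp add: translate_def euclid_def)

lemma translate_inverse:
  assumes "x \<in> euclid n" shows "translate n (\<lambda>i. - v i) (translate n v x) = x"
    "translate n v (translate n (\<lambda>i. - v i) x) = x"
  using assms by (auto simp: translate_def euclid_def fun_eq_iff PiE_def extensional_def)

lemma hausdorff_translate:
  assumes "S \<subseteq> euclid n"
  shows "hausdorff_codim1 n (translate n v ` S) = hausdorff_codim1 n S"
proof (rule hausdorff_measure_isometry[where T' = "translate n (\<lambda>i. - v i)"])
  show "euclid_dist n (translate n v x) (translate n v y) = euclid_dist n x y" for x y
    by (auto simp: euclid_dist_def L2_set_def translate_def
        intro!: arg_cong[where f = sqrt] sum.cong)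
qed (use assms in \<open>auto simp: translate_inverse\<close>)

definition permute_coords :: "nat \<Rightarrow> (nat \<Rightarrow> nat) \<Rightarrow> (nat \<Rightarrow> real) \<Rightarrow> nat \<Rightarrow> real" where
  "permute_coords n p x = (\<lambda>i\<in>{1..n}. x (p i))"

lemma permute_coords_in_euclid [simp]: "permute_coords n p x \<in> euclid n"
  by (simp add: permute_coords_def euclid_def)

lemma permute_coords_inverse:
  assumes "p permutes {1..n}" "x \<in> euclid n"
  shows "permute_coords n (inv p) (permute_coords n p x) = x"
    "permute_coords n p (permute_coords n (inv p) x) = x"
  using assms permutes_in_image[OF assms(1)] permutes_in_image[OF permutes_inv[OF assms(1)]]
  by (auto simp: permute_coords_def euclid_def fun_eq_iff PiE_def extensional_def
      permutes_inverses simp del: atLeastAtMost_iff)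

lemma hausdorff_permute_coords:
  assumes p: "p permutes {1..n}" and S: "S \<subseteq> euclid n"
  shows "hausdorff_codim1 n (permute_coords n p ` S) = hausdorff_codim1 n S"
proof (rule hausdorff_measure_isometry[where T' = "permute_coords n (inv p)"])
  show "euclid_dist n (permute_coords n p x) (permute_coords n p y) = euclid_dist n x y" for x y
    using sum.permute[OF p, of "\<lambda>i. (x i - y i)\<^sup>2"]
    by (simp add: euclid_dist_def L2_set_def permute_coords_def o_def)
qed (use assms in \<open>auto simp: permute_coords_inverse\<close>)

section \<open>Hausdorff measure of a hyperplane is locally finite and not zero\<close>

text \<open>
  Contents are defined by infinite sequences of sets; a finite cover is padded with empty sets,
  which weigh nothing.
\<close>
lemma hausdorff_content_finite_cover:
  assumes fin: "finite J" and V: "\<And>z. z \<in> J \<Longrightarrow> V z \<subseteq> M"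
    "\<And>z. z \<in> J \<Longrightarrow> ediameter d (V z) \<le> ennreal \<delta>" and S: "S \<subseteq> (\<Union>z\<in>J. V z)"
  shows "hausdorff_content M d m \<delta> S \<le> (\<Sum>z\<in>J. hausdorff_weight d m (V z))"
proof -
  obtain h where h: "bij_betw h {..<card J} J"
    using ex_bij_betw_nat_finite[OF fin] by (auto simp: atLeast0LessThan)
  have hJ: "h j \<in> J" if "j < card J" for j using bij_betwE[OF h] that by auto
  define U where "U j = (if j < card J then V (h j) else {})" for j
  have "hausdorff_content M d m \<delta> S \<le> (\<Sum>j. hausdorff_weight d m (U j))"
  proof (rule hausdorff_content_le)
    show "S \<subseteq> (\<Union>j. U j)"
    proof
      fix x assume "x \<in> S"
      then obtain z where z: "z \<in> J" "x \<in> V z" using S by auto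
      then obtain j where "j < card J" "z = h j"
        using bij_betw_imp_surj_on[OF h] by blast
      with z have "j < card J" "x \<in> V (h j)" by simp_all
      then show "x \<in> (\<Union>j. U j)" by (auto simp: U_def)
    qed
  qed (use V hJ in \<open>auto simp: U_def\<close>)
  also have "\<dots> = (\<Sum>j<card J. hausdorff_weight d m (U j))"
    by (rule suminf_finite) (auto simp: U_def)
  also have "\<dots> = (\<Sum>j<card J. hausdorff_weight d m (V (h j)))"
    by (rule sum.cong) (auto simp: U_def)
  also have "\<dots> = (\<Sum>z\<in>J. hausdorff_weight d m (V z))"
    by (rule sum.reindex_bij_betw[OF h])
  finally show ?thesis .
qed

text \<open>
  Two points of a hyperplane differ in the last coordinate by minus the sum of their other
  differences, so the projection to the first \<open>m\<close> coordinates has a Lipschitz inverse.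
\<close>
lemma euclid_dist_hyperplane_le:
  assumes "x \<in> hyperplane (Suc m) k" "y \<in> hyperplane (Suc m) k"
    and "\<And>i. i \<in> {1..m} \<Longrightarrow> \<bar>x i - y i\<bar> \<le> r"
  shows "euclid_dist (Suc m) x y \<le> 2 * real m * r"
proof -
  have "x (Suc m) - y (Suc m) = - (\<Sum>i=1..m. x i - y i)"
    using assms(1,2) by (simp add: hyperplane_def sum_subtractf)
  then have "\<bar>x (Suc m) - y (Suc m)\<bar> \<le> (\<Sum>i=1..m. \<bar>x i - y i\<bar>)" by simp
  moreover have "(\<Sum>i=1..m. \<bar>x i - y i\<bar>) \<le> real m * r"
    using sum_bounded_above[of "{1..m}" "\<lambda>i. \<bar>x i - y i\<bar>" r] assms(3) by simp
  moreover have "euclid_dist (Suc m) x y \<le> (\<Sum>i=1..Suc m. \<bar>x i - y i\<bar>)"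
    unfolding euclid_dist_def by (rule L2_set_le_sum_abs)
  ultimately show ?thesis by simp
qed

text \<open>
  The part of the hyperplane \<open>x\<^sub>1 + \<dots> + x\<^sub>m\<^sub>+\<^sub>1 = k\<close> that lies above \<open>B\<close> in the projection to the first
  \<open>m\<close> coordinates.
\<close>
definition over :: "nat \<Rightarrow> nat \<Rightarrow> (nat \<Rightarrow> real) set \<Rightarrow> (nat \<Rightarrow> real) set" where
  "over m k B = {x \<in> hyperplane (Suc m) k. restrict x {1..m} \<in> B}"

text \<open>
  A grid of mesh \<open>s = 2 R / N\<close> divides the cube into \<open>N\<^sup>m\<close> cells, each of diameter at most \<open>2 m s\<close> when
  lifted to the hyperplane. The total weight \<open>N\<^sup>m (2 m s)\<^sup>m = (4 m R)\<^sup>m\<close>, up to the constant in the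
  weight, is independent of \<open>N\<close>.
\<close>
lemma hausdorff_over_cube_finite:
  assumes R: "0 < R"
  shows "hausdorff_codim1 (Suc m) (over m k ({1..m} \<rightarrow>\<^sub>E {-R..<R})) < top"
proof -
  define w where "w = unit_ball_vol (real m) / 2 ^ m"
  have w: "0 \<le> w" by (simp add: w_def)
  have "hausdorff_content (euclid (Suc m)) (euclid_dist (Suc m)) m \<delta>
      (over m k ({1..m} \<rightarrow>\<^sub>E {-R..<R})) \<le> ennreal (w * (4 * real m * R) ^ m)" if \<delta>: "\<delta> > 0" for \<delta>
  proof -
    obtain N where N: "4 * real m * R / \<delta> < real (Suc N)"
      using reals_Archimedean2 by (meson less_trans lessI of_nat_less_iff)
    define s where "s = 2 * R / real (Suc N)"
    have s: "0 < s" using R by (simp add: s_def)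
    have sd: "2 * real m * s \<le> \<delta>" using N \<delta> by (simp add: s_def field_simps)
    define J where "J = {1..m} \<rightarrow>\<^sub>E {..<Suc N}"
    define V where "V z = {x \<in> hyperplane (Suc m) k.
      \<forall>i\<in>{1..m}. - R + s * real (z i) \<le> x i \<and> x i \<le> - R + s * (real (z i) + 1)}" for z :: "nat \<Rightarrow> nat"
    have diam: "ediameter (euclid_dist (Suc m)) (V z) \<le> ennreal (2 * real m * s)" for z
    proof (rule ediameter_least)
      fix x y assume xy: "x \<in> V z" "y \<in> V z"
      have "\<bar>x i - y i\<bar> \<le> s" if "i \<in> {1..m}" for i
        using xy that by (force simp: V_def algebra_simps abs_le_iff)
      then show "ennreal (euclid_dist (Suc m) x y) \<le> ennreal (2 * real m * s)"
        using xy by (intro ennreal_leI euclid_dist_hyperplane_le) (auto simp: V_def)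
    qed
    have "hausdorff_content (euclid (Suc m)) (euclid_dist (Suc m)) m \<delta>
      (over m k ({1..m} \<rightarrow>\<^sub>E {-R..<R})) \<le> (\<Sum>z\<in>J. hausdorff_weight (euclid_dist (Suc m)) m (V z))"
    proof (rule hausdorff_content_finite_cover)
      show "finite J" unfolding J_def by (intro finite_PiE) auto
      show "V z \<subseteq> euclid (Suc m)" for z by (auto simp: V_def hyperplane_def)
      show "ediameter (euclid_dist (Suc m)) (V z) \<le> ennreal \<delta>" for z
        using diam[of z] ennreal_leI[OF sd] by (rule order_trans)
      show "over m k ({1..m} \<rightarrow>\<^sub>E {-R..<R}) \<subseteq> (\<Union>z\<in>J. V z)"
      proof
        fix x assume x: "x \<in> over m k ({1..m} \<rightarrow>\<^sub>E {-R..<R})"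
        define z where "z = (\<lambda>i\<in>{1..m}. nat \<lfloor>(x i + R) / s\<rfloor>)"
        have z: "- R + s * real (z i) \<le> x i \<and> x i \<le> - R + s * (real (z i) + 1) \<and> z i < Suc N"
          if i: "i \<in> {1..m}" for i
        proof -
          have xi: "- R \<le> x i" "x i < R" using x i by (auto simp: over_def PiE_iff)
          have zi: "real (z i) = of_int \<lfloor>(x i + R) / s\<rfloor>"
            using i xi s by (simp add: z_def)
          have "real (z i) \<le> (x i + R) / s" "(x i + R) / s \<le> real (z i) + 1"
            unfolding zi by linarith+
          moreover have "(x i + R) / s < real (Suc N)"
          proof -
            have "(x i + R) / s < 2 * R / s" using xi s by (intro divide_strict_right_mono) auto
            also have "\<dots> = real (Suc N)" using R by (simp add: s_def)
            finally show ?thesis .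
          qed
          ultimately have "real (z i) \<le> (x i + R) / s" "(x i + R) / s \<le> real (z i) + 1"
            "real (z i) < real (Suc N)" by linarith+
          then show ?thesis using s by (simp add: field_simps)
        qed
        then have "z \<in> J" by (auto simp: J_def z_def)
        moreover have "x \<in> V z" using x z by (auto simp: V_def over_def)
        ultimately show "x \<in> (\<Union>z\<in>J. V z)" by blast
      qed
    qed
    also have "\<dots> \<le> (\<Sum>z\<in>J. ennreal w * ennreal (2 * real m * s) ^ m)"
      using diam by (intro sum_mono) (auto simp: hausdorff_weight_def w_def intro!: mult_left_mono power_mono)
    also have "\<dots> = of_nat (Suc N ^ m) * (ennreal w * ennreal (2 * real m * s) ^ m)"
      by (simp add: J_def card_PiE)
    also have "\<dots> = ennreal (real (Suc N ^ m)) * (ennreal w * ennreal (2 * real m * s) ^ m)"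
      by (simp only: ennreal_of_nat_eq_real_of_nat)
    also have "\<dots> = ennreal (real (Suc N ^ m) * (w * (2 * real m * s) ^ m))"
      using s w by (simp only: ennreal_power ennreal_mult'[symmetric] mult_nonneg_nonneg
          zero_le_power of_nat_0_le_iff less_imp_le zero_le_numeral)
    also have "real (Suc N ^ m) * (w * (2 * real m * s) ^ m) = w * (real (Suc N) * (2 * real m * s)) ^ m"
      by (simp add: power_mult_distrib)
    also have "real (Suc N) * (2 * real m * s) = 4 * real m * R" by (simp add: s_def field_simps)
    finally show ?thesis .
  qed
  then have "hausdorff_codim1 (Suc m) (over m k ({1..m} \<rightarrow>\<^sub>E {-R..<R}))
      \<le> ennreal (w * (4 * real m * R) ^ m)"
    unfolding hausdorff_measure_def by (intro SUP_least) simp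
  also have "\<dots> < top" by simp
  finally show ?thesis .
qed

lemma over_lift:
  assumes "y \<in> {1..m} \<rightarrow>\<^sub>E A"
  shows "y(Suc m := real k - (\<Sum>i=1..m. y i)) \<in> hyperplane (Suc m) k"
    "restrict (y(Suc m := real k - (\<Sum>i=1..m. y i))) {1..m} = y"
proof -
  let ?x = "y(Suc m := real k - (\<Sum>i=1..m. y i))"
  have "?x i = undefined" if "i \<notin> {1..Suc m}" for i
    using that assms by (auto simp: PiE_def extensional_def)
  then show "?x \<in> hyperplane (Suc m) k"
    by (auto simp: hyperplane_def euclid_def PiE_def extensional_def)
  show "restrict ?x {1..m} = y"
    using assms by (auto simp: PiE_def extensional_def fun_eq_iff)
qed

lemma emeasure_box:
  assumes "\<And>i. i \<in> {1..m} \<Longrightarrow> l i \<le> u i"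
  shows "emeasure (lebesgue_cartesian m) (\<Pi>\<^sub>E i\<in>{1..m}. {l i..u i}) = ennreal (\<Prod>i=1..m. u i - l i)"
proof -
  have "emeasure (lebesgue_cartesian m) (\<Pi>\<^sub>E i\<in>{1..m}. {l i..u i})
      = (\<Prod>i=1..m. emeasure lborel {l i..u i})"
    by (rule lborel_product.emeasure_PiM) auto
  also have "\<dots> = (\<Prod>i=1..m. ennreal (u i - l i))"
    using assms by (intro prod.cong) auto
  also have "\<dots> = ennreal (\<Prod>i=1..m. u i - l i)"
    using assms by (intro prod_ennreal) auto
  finally show ?thesis .
qed

text \<open>
  A covering set of diameter \<open>r\<close> projects into a cube of side \<open>2 r\<close> centred at the projection of one
  of its points, so its weight is at least \<open>unit_ball_vol m / 4\<^sup>m\<close> times the Lebesgue measure of that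
  cube. The constant is not optimal, but it is positive.
\<close>
lemma hausdorff_over_ge_lebesgue:
  assumes B: "B \<in> sets (lebesgue_cartesian m)"
  shows "ennreal (unit_ball_vol (real m) / 4 ^ m) * emeasure (lebesgue_cartesian m) B
    \<le> hausdorff_codim1 (Suc m) (over m k B)"
proof -
  define v where "v = unit_ball_vol (real m) / 4 ^ m"
  have v: "0 \<le> v" by (simp add: v_def)
  have "ennreal v * emeasure (lebesgue_cartesian m) B
    \<le> hausdorff_content (euclid (Suc m)) (euclid_dist (Suc m)) m 1 (over m k B)"
  proof (rule hausdorff_content_greatest)
    fix U :: "nat \<Rightarrow> (nat \<Rightarrow> real) set"
    assume U: "\<And>j. U j \<subseteq> euclid (Suc m)"
      "\<And>j. ediameter (euclid_dist (Suc m)) (U j) \<le> ennreal 1" "over m k B \<subseteq> (\<Union>j. U j)"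
    define r where "r j = enn2real (ediameter (euclid_dist (Suc m)) (U j))" for j
    have r: "ediameter (euclid_dist (Suc m)) (U j) = ennreal (r j)" "0 \<le> r j" for j
      using order.strict_trans1[OF U(2)[of j] ennreal_less_top] by (simp_all add: r_def)
    define u where "u j = (SOME x. x \<in> U j)" for j
    define Q where "Q j = (if U j = {} then {} else \<Pi>\<^sub>E i\<in>{1..m}. {u j i - r j..u j i + r j})" for j
    have Qs: "Q j \<in> sets (lebesgue_cartesian m)" for j
      by (auto simp: Q_def intro!: sets_PiM_I_finite)
    have cover: "B \<subseteq> (\<Union>j. Q j)"
    proof
      fix y assume y: "y \<in> B"
      then have ye: "y \<in> {1..m} \<rightarrow>\<^sub>E UNIV"
        using sets.sets_into_space[OF B] by (auto simp: euclid_def)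
      let ?x = "y(Suc m := real k - (\<Sum>i=1..m. y i))"
      have "?x \<in> over m k B" using over_lift[OF ye] y by (simp add: over_def)
      then obtain j where j: "?x \<in> U j" using U(3) by auto
      then have uj: "u j \<in> U j" unfolding u_def by (rule someI[of "\<lambda>x. x \<in> U j"])
      have "ennreal (euclid_dist (Suc m) ?x (u j)) \<le> ennreal (r j)"
        using ediameter_upper[OF j uj] r(1) by metis
      then have "euclid_dist (Suc m) ?x (u j) \<le> r j" using r(2)[of j] by (simp add: ennreal_le_iff)
      then have "\<bar>?x i - u j i\<bar> \<le> r j" if "i \<in> {1..m}" for i
        using coord_dist_le[of i "Suc m" ?x "u j"] that by (simp del: fun_upd_apply)
      note x = this
      have "u j i - r j \<le> y i \<and> y i \<le> u j i + r j" if "i \<in> {1..m}" for i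
        using x[OF that] that by (auto simp: abs_le_iff)
      then have "y \<in> Q j" using j ye by (auto simp: Q_def PiE_iff)
      then show "y \<in> (\<Union>j. Q j)" by blast
    qed
    have one: "ennreal v * emeasure (lebesgue_cartesian m) (Q j)
        \<le> hausdorff_weight (euclid_dist (Suc m)) m (U j)" for j
    proof (cases "U j = {}")
      case False
      have "emeasure (lebesgue_cartesian m) (Q j) = ennreal ((2 * r j) ^ m)"
        using False r(2)[of j] by (simp add: Q_def emeasure_box)
      moreover have "v * (2 * r j) ^ m = unit_ball_vol (real m) / 2 ^ m * r j ^ m"
      proof -
        have "(4::real) ^ m = 2 ^ m * 2 ^ m" by (simp flip: power_mult_distrib)
        then show ?thesis by (simp add: v_def power_mult_distrib)
      qed
      ultimately show ?thesis
        using False r v by (simp add: hausdorff_weight_def ennreal_power flip: ennreal_mult)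
    qed (simp add: Q_def)
    have "ennreal v * emeasure (lebesgue_cartesian m) B
        \<le> ennreal v * (\<Sum>j. emeasure (lebesgue_cartesian m) (Q j))"
    proof (intro mult_left_mono)
      have "emeasure (lebesgue_cartesian m) B \<le> emeasure (lebesgue_cartesian m) (\<Union>j. Q j)"
        using cover Qs by (intro emeasure_mono) auto
      also have "\<dots> \<le> (\<Sum>j. emeasure (lebesgue_cartesian m) (Q j))"
        using Qs by (intro emeasure_subadditive_countably) auto
      finally show "emeasure (lebesgue_cartesian m) B \<le> \<dots>" .
    qed simp
    also have "\<dots> = (\<Sum>j. ennreal v * emeasure (lebesgue_cartesian m) (Q j))"
      by (rule ennreal_suminf_cmult[symmetric])
    also have "\<dots> \<le> (\<Sum>j. hausdorff_weight (euclid_dist (Suc m)) m (U j))"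
      by (intro suminf_le one) auto
    finally show "ennreal v * emeasure (lebesgue_cartesian m) B
        \<le> (\<Sum>j. hausdorff_weight (euclid_dist (Suc m)) m (U j))" .
  qed
  also have "\<dots> \<le> hausdorff_codim1 (Suc m) (over m k B)"
    using hausdorff_content_le_measure[of 1] by simp
  finally show ?thesis by (simp add: v_def)
qed

section \<open>A translation-invariant measure is a multiple of Lebesgue measure\<close>

lemma translate_commute: "translate n x y = translate n y x"
  by (simp add: translate_def add.commute)

lemma measurable_translate:
  assumes "\<And>i. i \<in> {1..n} \<Longrightarrow> (\<lambda>w. v w i) \<in> borel_measurable M"
    and "\<And>i. i \<in> {1..n} \<Longrightarrow> (\<lambda>w. x w i) \<in> borel_measurable M"
  shows "(\<lambda>w. translate n (v w) (x w)) \<in> measurable M (lebesgue_cartesian n)"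
  unfolding translate_def using assms by (intro measurable_restrict) simp

lemma emeasure_lebesgue_translate:
  assumes B: "B \<in> sets (lebesgue_cartesian m)"
  shows "emeasure (lebesgue_cartesian m) {y \<in> euclid m. translate m x y \<in> B}
    = emeasure (lebesgue_cartesian m) B"
proof -
  let ?L = "lebesgue_cartesian m"
  have [measurable]: "translate m x \<in> measurable ?L ?L"
    by (intro measurable_translate) auto
  have "distr ?L ?L (translate m x) = ?L"
  proof (rule lborel_product.PiM_eqI)
    fix A :: "nat \<Rightarrow> real set" assume A: "\<And>i. i \<in> {1..m} \<Longrightarrow> A i \<in> sets lborel"
    have AS: "Pi\<^sub>E {1..m} A \<in> sets ?L" using A by (intro sets_PiM_I_finite) auto
    have sh: "emeasure lborel ((+) (x i) -` A i) = emeasure lborel (A i)"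
      "(+) (x i) -` A i \<in> sets lborel" if "i \<in> {1..m}" for i
    proof -
      have "emeasure (distr lborel borel ((+) (x i))) (A i) = emeasure lborel (A i)"
        by (simp add: lborel_distr_plus)
      then show "emeasure lborel ((+) (x i) -` A i) = emeasure lborel (A i)"
        using A[OF that] by (subst (asm) emeasure_distr) auto
      show "(+) (x i) -` A i \<in> sets lborel"
        using A[OF that] measurable_sets[of "(+) (x i)" lborel borel "A i"] by auto
    qed
    have "emeasure (distr ?L ?L (translate m x)) (Pi\<^sub>E {1..m} A)
        = emeasure ?L (translate m x -` Pi\<^sub>E {1..m} A \<inter> space ?L)"
      using AS by (intro emeasure_distr) auto
    also have "translate m x -` Pi\<^sub>E {1..m} A \<inter> space ?L = Pi\<^sub>E {1..m} (\<lambda>i. (+) (x i) -` A i)"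
      by (auto simp: translate_def euclid_def PiE_iff add.commute)
    also have "emeasure ?L \<dots> = (\<Prod>i=1..m. emeasure lborel ((+) (x i) -` A i))"
      using sh by (intro lborel_product.emeasure_PiM) auto
    also have "\<dots> = (\<Prod>i=1..m. emeasure lborel (A i))"
      using sh by (intro prod.cong) auto
    finally show "emeasure (distr ?L ?L (translate m x)) (Pi\<^sub>E {1..m} A)
        = (\<Prod>i=1..m. emeasure lborel (A i))" .
  qed auto
  then have "emeasure ?L B = emeasure (distr ?L ?L (translate m x)) B" by simp
  also have "\<dots> = emeasure ?L (translate m x -` B \<inter> space ?L)"
    using B by (intro emeasure_distr) auto
  finally show ?thesis by (simp add: vimage_def Collect_conj_eq Int_commute)
qed

text \<open>
  Uniqueness of Haar measure by Fubini's theorem. For fixed \<open>y\<close>, translation by \<open>y\<close> takes the section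
  \<open>{x \<in> C | x + y \<in> B}\<close> to \<open>{z \<in> B | z - y \<in> C}\<close>, where \<open>C\<close> is the closed unit cube. Hence
  the two sets of pairs have the same product measure. Integrated in the other order, the first set gives
  \<open>\<mu> C\<close> times the Lebesgue measure of \<open>B\<close>, and the second gives \<open>\<mu> B\<close>, because \<open>z - y \<in> C\<close> says that
  \<open>y\<close> lies in the unit cube with upper corner \<open>z\<close>.
\<close>
lemma translation_invariant_eq_lebesgue:
  assumes sets: "sets \<mu> = sets (lebesgue_cartesian m)" and sf: "sigma_finite_measure \<mu>"
    and inv: "\<And>y A. A \<in> sets (lebesgue_cartesian m)
      \<Longrightarrow> emeasure \<mu> {x \<in> euclid m. translate m y x \<in> A} = emeasure \<mu> A"
    and B: "B \<in> sets (lebesgue_cartesian m)"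
  shows "emeasure \<mu> B = emeasure \<mu> ({1..m} \<rightarrow>\<^sub>E {0..1}) * emeasure (lebesgue_cartesian m) B"
proof -
  let ?L = "lebesgue_cartesian m" and ?C = "{1..m} \<rightarrow>\<^sub>E {0..1::real}"
  interpret L: sigma_finite_measure ?L by (rule sigma_finite_lebesgue_cartesian)
  interpret mu: sigma_finite_measure \<mu> by (rule sf)
  interpret pair_sigma_finite \<mu> ?L ..
  have sp: "space \<mu> = euclid m" using sets_eq_imp_space_eq[OF sets] by simp
  note [measurable_cong] = sets
  have C[measurable]: "?C \<in> sets ?L" by (intro sets_PiM_I_finite) auto
  note [measurable] = B
  have P: "{w \<in> space (\<mu> \<Otimes>\<^sub>M ?L). Q w} = {w \<in> euclid m \<times> euclid m. Q w}" for Q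
    by (simp add: space_pair_measure sp)
  have [measurable]: "(\<lambda>w. translate m (snd w) (fst w)) \<in> measurable (\<mu> \<Otimes>\<^sub>M ?L) ?L"
    "(\<lambda>w. translate m (\<lambda>i. - snd w i) (fst w)) \<in> measurable (\<mu> \<Otimes>\<^sub>M ?L) ?L"
    by (auto intro!: measurable_translate)
  define X where "X = {w \<in> space (\<mu> \<Otimes>\<^sub>M ?L). fst w \<in> ?C \<and> translate m (snd w) (fst w) \<in> B}"
  define Y where "Y = {w \<in> space (\<mu> \<Otimes>\<^sub>M ?L). fst w \<in> B \<and> translate m (\<lambda>i. - snd w i) (fst w) \<in> ?C}"
  have X: "X \<in> sets (\<mu> \<Otimes>\<^sub>M ?L)" unfolding X_def by measurable
  have Y: "Y \<in> sets (\<mu> \<Otimes>\<^sub>M ?L)" unfolding Y_def by measurable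
  have Ce: "?C \<subseteq> euclid m" and Be: "B \<subseteq> euclid m"
    using sets.sets_into_space[OF B] by (auto simp: euclid_def)
  have "emeasure (\<mu> \<Otimes>\<^sub>M ?L) X = (\<integral>\<^sup>+ x. emeasure ?L (Pair x -` X) \<partial>\<mu>)"
    by (rule L.emeasure_pair_measure_alt[OF X])
  also have "\<dots> = (\<integral>\<^sup>+ x. emeasure ?L B * indicator ?C x \<partial>\<mu>)"
  proof (rule nn_integral_cong)
    fix x assume "x \<in> space \<mu>"
    then have "Pair x -` X = (if x \<in> ?C then {y \<in> euclid m. translate m x y \<in> B} else {})"
      using Ce by (auto simp: X_def P sp translate_commute[of m _ x])
    then show "emeasure ?L (Pair x -` X) = emeasure ?L B * indicator ?C x"
      by (simp add: emeasure_lebesgue_translate B)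
  qed
  also have "\<dots> = emeasure \<mu> ?C * emeasure ?L B"
    by (subst nn_integral_cmult_indicator) (auto simp: sets mult.commute)
  finally have 1: "emeasure (\<mu> \<Otimes>\<^sub>M ?L) X = emeasure \<mu> ?C * emeasure ?L B" .
  have "emeasure (\<mu> \<Otimes>\<^sub>M ?L) Y = (\<integral>\<^sup>+ z. emeasure ?L (Pair z -` Y) \<partial>\<mu>)"
    by (rule L.emeasure_pair_measure_alt[OF Y])
  also have "\<dots> = (\<integral>\<^sup>+ z. indicator B z \<partial>\<mu>)"
  proof (rule nn_integral_cong)
    fix z assume z: "z \<in> space \<mu>"
    have "translate m (\<lambda>i. - y i) z \<in> ?C \<longleftrightarrow> (\<forall>i\<in>{1..m}. y i \<in> {z i - 1..z i})" for y
      by (auto simp: translate_def algebra_simps)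
    then have "Pair z -` Y = (if z \<in> B then \<Pi>\<^sub>E i\<in>{1..m}. {z i - 1..z i} else {})"
      using z by (simp add: Y_def P sp set_eq_iff) (simp add: euclid_def PiE_iff conj_commute)
    then show "emeasure ?L (Pair z -` Y) = indicator B z"
      by (simp add: emeasure_box)
  qed
  also have "\<dots> = emeasure \<mu> B" using B by (simp add: sets)
  finally have 2: "emeasure (\<mu> \<Otimes>\<^sub>M ?L) Y = emeasure \<mu> B" .
  have "emeasure (\<mu> \<Otimes>\<^sub>M ?L) X = (\<integral>\<^sup>+ y. emeasure \<mu> ((\<lambda>x. (x, y)) -` X) \<partial>?L)"
    by (rule emeasure_pair_measure_alt2[OF X])
  also have "\<dots> = (\<integral>\<^sup>+ y. emeasure \<mu> ((\<lambda>x. (x, y)) -` Y) \<partial>?L)"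
  proof (rule nn_integral_cong)
    fix y assume y: "y \<in> space ?L"
    have Yy: "(\<lambda>x. (x, y)) -` Y \<in> sets ?L"
      using sets_Pair2[OF Y] by (simp add: sets)
    have "(\<lambda>x. (x, y)) -` X = {x \<in> euclid m. translate m y x \<in> (\<lambda>x. (x, y)) -` Y}"
      using y Ce by (auto simp: X_def Y_def P translate_inverse)
    then show "emeasure \<mu> ((\<lambda>x. (x, y)) -` X) = emeasure \<mu> ((\<lambda>x. (x, y)) -` Y)"
      using inv[OF Yy] by simp
  qed
  also have "\<dots> = emeasure (\<mu> \<Otimes>\<^sub>M ?L) Y"
    by (rule emeasure_pair_measure_alt2[OF Y, symmetric])
  finally show ?thesis using 1 2 by simp
qed

section \<open>Hausdorff measure of a hyperplane is a multiple of Lebesgue measure\<close>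

lemma over_subset: "over m k B \<subseteq> euclid (Suc m)"
  by (auto simp: over_def hyperplane_def)

lemma sets_hyperplane [measurable]: "hyperplane n k \<in> sets (lebesgue_cartesian n)"
proof -
  have "hyperplane n k = {x \<in> space (lebesgue_cartesian n). (\<Sum>i=1..n. x i) = real k}"
    by (simp add: hyperplane_def)
  also have "\<dots> \<in> sets (lebesgue_cartesian n)" by measurable
  finally show ?thesis .
qed

text \<open>
  In \<open>m\<close>-space, unlike on the hyperplane, the comparison with Lebesgue measure makes sense; the
  projection along the last coordinate transports the surface measure there.
\<close>
definition slice_measure :: "nat \<Rightarrow> nat \<Rightarrow> (nat \<Rightarrow> real) measure" where
  "slice_measure m k = distr (restrict_space (surface_measure (Suc m)) (hyperplane (Suc m) k))
    (lebesgue_cartesian m) (\<lambda>x. restrict x {1..m})"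

lemma measurable_restrict_coords:
  "(\<lambda>x. restrict x {1..m}) \<in> measurable (lebesgue_cartesian (Suc m)) (lebesgue_cartesian m)"
  by (rule measurable_restrict_subset) auto

lemma sets_over:
  assumes "B \<in> sets (lebesgue_cartesian m)"
  shows "over m k B \<in> sets (lebesgue_cartesian (Suc m))"
proof -
  have "over m k B = hyperplane (Suc m) k
      \<inter> ((\<lambda>x. restrict x {1..m}) -` B \<inter> space (lebesgue_cartesian (Suc m)))"
    by (auto simp: over_def hyperplane_def)
  also have "\<dots> \<in> sets (lebesgue_cartesian (Suc m))"
    by (rule sets.Int[OF sets_hyperplane measurable_sets[OF measurable_restrict_coords assms]])
  finally show ?thesis .
qed

lemma emeasure_slice:
  assumes B: "B \<in> sets (lebesgue_cartesian m)"
  shows "emeasure (slice_measure m k) B = hausdorff_codim1 (Suc m) (over m k B)"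
proof -
  let ?R = "restrict_space (surface_measure (Suc m)) (hyperplane (Suc m) k)"
  have sp: "space ?R = hyperplane (Suc m) k"
    by (auto simp: space_restrict_space hyperplane_def)
  have "(\<lambda>x. restrict x {1..m}) \<in> measurable (surface_measure (Suc m)) (lebesgue_cartesian m)"
    using measurable_restrict_coords by (simp cong: measurable_cong_sets)
  then have "(\<lambda>x. restrict x {1..m}) \<in> measurable ?R (lebesgue_cartesian m)"
    by (rule measurable_restrict_space1)
  then have "emeasure (slice_measure m k) B = emeasure ?R ((\<lambda>x. restrict x {1..m}) -` B \<inter> space ?R)"
    unfolding slice_measure_def using B by (rule emeasure_distr)
  also have "(\<lambda>x. restrict x {1..m}) -` B \<inter> space ?R = over m k B"
    unfolding sp by (auto simp: over_def)
  also have "emeasure ?R (over m k B) = emeasure (surface_measure (Suc m)) (over m k B)"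
  proof (rule emeasure_restrict_space)
    show "hyperplane (Suc m) k \<inter> space (surface_measure (Suc m)) \<in> sets (surface_measure (Suc m))"
      unfolding sets_surface_measure using sets.Int[OF sets_hyperplane sets.top] by simp
  qed (auto simp: over_def)
  also have "\<dots> = hausdorff_codim1 (Suc m) (over m k B)"
    by (rule emeasure_surface_measure[OF sets_over[OF B]])
  finally show ?thesis .
qed

text \<open>
  A translation of the first \<open>m\<close> coordinates by \<open>y\<close> extends to a translation of \<open>m + 1\<close>-space that
  takes the hyperplane at level \<open>k\<close> to the one at level \<open>l\<close>. This gives at once the translation
  invariance of the slice measures and their independence of the level.
\<close>
lemma hausdorff_over_translate:
  "hausdorff_codim1 (Suc m) (over m k {x \<in> euclid m. translate m y x \<in> A})
    = hausdorff_codim1 (Suc m) (over m l A)"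
proof -
  define v where "v = y(Suc m := real l - real k - (\<Sum>i=1..m. y i))"
  have sub: "translate (Suc m) u ` over m k' {x \<in> euclid m. translate m u x \<in> A'} \<subseteq> over m l' A'"
    if "u (Suc m) = real l' - real k' - (\<Sum>i=1..m. u i)" for u k' l' A'
  proof (clarify)
    fix x assume x: "x \<in> over m k' {x \<in> euclid m. translate m u x \<in> A'}"
    then have "restrict (translate (Suc m) u x) {1..m} = translate m u (restrict x {1..m})"
      by (auto simp: translate_def fun_eq_iff)
    moreover have "(\<Sum>i=1..Suc m. translate (Suc m) u x i) = (\<Sum>i=1..Suc m. x i) + (\<Sum>i=1..Suc m. u i)"
      by (simp add: translate_def sum.distrib)
    ultimately show "translate (Suc m) u x \<in> over m l' A'"
      using x that by (simp add: over_def hyperplane_def)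
  qed
  \<comment> \<open>The last entry of \<open>v\<close> only matters for the hyperplane, not for the projection.\<close>
  have vy: "translate m v x = translate m y x" for x
    by (auto simp: translate_def v_def fun_eq_iff)
  have "translate (Suc m) v ` over m k {x \<in> euclid m. translate m y x \<in> A} = over m l A"
  proof
    show "translate (Suc m) v ` over m k {x \<in> euclid m. translate m y x \<in> A} \<subseteq> over m l A"
      using sub[of v l k A] unfolding vy by (simp add: v_def)
    show "over m l A \<subseteq> translate (Suc m) v ` over m k {x \<in> euclid m. translate m y x \<in> A}"
    proof
      fix x assume x: "x \<in> over m l A"
      let ?u = "\<lambda>i. - v i"
      have e: "restrict x {1..m} \<in> euclid m" by (auto simp: euclid_def)
      have "translate m ?u z \<in> euclid m" for z by simp
      moreover have "x \<in> over m l {z \<in> euclid m. translate m ?u z \<in> {x \<in> euclid m. translate m y x \<in> A}}"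
        using x e translate_inverse(2)[OF e, of v] unfolding vy by (simp add: over_def vy)
      ultimately have "translate (Suc m) ?u x \<in> over m k {x \<in> euclid m. translate m y x \<in> A}"
        using sub[of ?u k l "{x \<in> euclid m. translate m y x \<in> A}"] by (auto simp: v_def sum_negf)
      moreover have "translate (Suc m) v (translate (Suc m) ?u x) = x"
        using x over_subset by (intro translate_inverse) auto
      ultimately show "x \<in> translate (Suc m) v ` over m k {x \<in> euclid m. translate m y x \<in> A}"
        by (metis imageI)
    qed
  qed
  then show ?thesis using hausdorff_translate[OF over_subset] by metis
qed

lemma sigma_finite_slice: "sigma_finite_measure (slice_measure m k)"
proof
  let ?A = "range (\<lambda>j::nat. {1..m} \<rightarrow>\<^sub>E {- real (Suc j)..<real (Suc j)})"
  have meas: "{1..m} \<rightarrow>\<^sub>E {- real (Suc j)..<real (Suc j)} \<in> sets (lebesgue_cartesian m)" for j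
    by (intro sets_PiM_I_finite) auto
  have sl: "sets (slice_measure m k) = sets (lebesgue_cartesian m)"
    by (simp add: slice_measure_def)
  have "\<Union>?A = space (slice_measure m k)"
  proof
    show "\<Union>?A \<subseteq> space (slice_measure m k)" by (auto simp: slice_measure_def euclid_def)
    show "space (slice_measure m k) \<subseteq> \<Union>?A"
    proof
      fix x assume "x \<in> space (slice_measure m k)"
      then have x: "x \<in> {1..m} \<rightarrow>\<^sub>E UNIV" by (simp add: slice_measure_def euclid_def)
      obtain j :: nat where j: "(\<Sum>i=1..m. \<bar>x i\<bar>) < real j" using reals_Archimedean2 by blast
      have "\<bar>x i\<bar> < real j" if "i \<in> {1..m}" for i
        using member_le_sum[of i "{1..m}" "\<lambda>i. \<bar>x i\<bar>"] that j by force
      then have "x \<in> {1..m} \<rightarrow>\<^sub>E {- real (Suc j)..<real (Suc j)}"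
        using x by (force simp: PiE_iff abs_less_iff)
      then show "x \<in> \<Union>?A" by blast
    qed
  qed
  moreover have "emeasure (slice_measure m k) a \<noteq> \<infinity>" if a: "a \<in> ?A" for a
  proof -
    obtain j where "a = {1..m} \<rightarrow>\<^sub>E {- real (Suc j)..<real (Suc j)}" using a by blast
    then have "emeasure (slice_measure m k) a < top"
      unfolding emeasure_slice[OF meas] \<open>a = _\<close>
      by (simp only: hausdorff_over_cube_finite of_nat_0_less_iff zero_less_Suc)
    then show ?thesis by simp
  qed
  ultimately show "\<exists>A. countable A \<and> A \<subseteq> sets (slice_measure m k) \<and> \<Union> A = space (slice_measure m k)
      \<and> (\<forall>a\<in>A. emeasure (slice_measure m k) a \<noteq> \<infinity>)"
    using meas unfolding sl by (intro exI[of _ ?A]) auto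
qed

text \<open>
  The constant is the Hausdorff measure of the unit cube lifted to a hyperplane. That it is neither
  \<open>0\<close> nor \<open>\<infinity>\<close> is what makes the quotient of volumes meaningful.
\<close>
theorem hausdorff_over_eq_lebesgue:
  obtains c where "0 < c" "\<And>k B. B \<in> sets (lebesgue_cartesian m)
    \<Longrightarrow> hausdorff_codim1 (Suc m) (over m k B) = ennreal c * emeasure (lebesgue_cartesian m) B"
proof
  let ?C = "{1..m} \<rightarrow>\<^sub>E {0..1::real}"
  define c where "c = enn2real (emeasure (slice_measure m 0) ?C)"
  have C: "?C \<in> sets (lebesgue_cartesian m)" by (intro sets_PiM_I_finite) auto
  have big: "over m 0 ?C \<subseteq> over m 0 ({1..m} \<rightarrow>\<^sub>E {-2..<2})"
    by (auto simp: over_def PiE_iff) (fastforce+)?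
  have "emeasure (slice_measure m 0) ?C < top"
    using le_less_trans[OF hausdorff_measure_mono[OF big] hausdorff_over_cube_finite]
    by (simp add: emeasure_slice[OF C])
  then have c: "emeasure (slice_measure m 0) ?C = ennreal c" by (simp add: c_def)
  have "ennreal (unit_ball_vol (real m) / 4 ^ m) * 1 \<le> ennreal c"
    using hausdorff_over_ge_lebesgue[OF C, of 0] emeasure_box[of m "\<lambda>_. 0" "\<lambda>_. 1"]
    by (simp add: emeasure_slice[OF C] flip: c)
  moreover have "0 < ennreal (unit_ball_vol (real m) / 4 ^ m)" by simp
  ultimately have "0 < ennreal c" by (simp del: ennreal_less_zero_iff)
  then show "0 < c" by simp
  fix k B assume B: "B \<in> sets (lebesgue_cartesian m)"
  have Be: "B \<subseteq> euclid m" using sets.sets_into_space[OF B] by simp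
  have "emeasure (slice_measure m 0) B = emeasure (slice_measure m 0) ?C * emeasure (lebesgue_cartesian m) B"
  proof (rule translation_invariant_eq_lebesgue[OF _ sigma_finite_slice _ B])
    fix y A assume A: "A \<in> sets (lebesgue_cartesian m)"
    have "translate m y \<in> measurable (lebesgue_cartesian m) (lebesgue_cartesian m)"
      by (intro measurable_translate) auto
    from measurable_sets[OF this A]
    have "{x \<in> euclid m. translate m y x \<in> A} \<in> sets (lebesgue_cartesian m)"
      by (simp add: vimage_def Collect_conj_eq Int_commute)
    then show "emeasure (slice_measure m 0) {x \<in> euclid m. translate m y x \<in> A}
        = emeasure (slice_measure m 0) A"
      using A hausdorff_over_translate[of m 0 y A 0] by (simp add: emeasure_slice)
  qed (simp add: slice_measure_def)
  moreover have "{x \<in> euclid m. translate m (\<lambda>_. 0) x \<in> B} = B"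
  proof -
    have "translate m (\<lambda>_. 0) x = x" if "x \<in> euclid m" for x
      using that by (auto simp: translate_def euclid_def PiE_def extensional_def)
    then show ?thesis using Be by auto
  qed
  ultimately show "hausdorff_codim1 (Suc m) (over m k B) = ennreal c * emeasure (lebesgue_cartesian m) B"
    using hausdorff_over_translate[of m k "\<lambda>_. 0" B 0] by (simp add: emeasure_slice B c)
qed

section \<open>Volumes of sections of a cube\<close>

text \<open>
  The truncated power \<open>x\<^sub>+\<^sup>m\<close>. For \<open>m = 0\<close> it is the indicator of \<open>[0,\<infinity>)\<close>, which includes \<open>0\<close>; with this
  convention half-open intervals come out exactly in the base case of \<open>cube_section_irwin_hall\<close>.
\<close>
definition pos_power :: "nat \<Rightarrow> real \<Rightarrow> real" where
  "pos_power m x = (if 0 \<le> x then x ^ m else 0)"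

text \<open>
  For \<open>a < 1\<close>, the density at \<open>s\<close> of the sum of \<open>m + 1\<close> independent variables uniform on \<open>[a,1)\<close>,
  multiplied by \<open>(1 - a)\<^sup>m\<^sup>+\<^sup>1\<close>. The case \<open>a = 0\<close> is the Irwin-Hall distribution.
\<close>
definition irwin_hall :: "real \<Rightarrow> nat \<Rightarrow> real \<Rightarrow> real" where
  "irwin_hall a m s = 1 / fact m * (\<Sum>j\<le>Suc m. (-1) ^ j * real (Suc m choose j)
      * pos_power m (s - real (Suc m) * a - real j * (1 - a)))"

lemma pos_power_Suc: "pos_power (Suc m) x = (max 0 x) ^ Suc m"
  by (simp add: pos_power_def max_def)

lemma pos_power_has_derivative:
  assumes "x \<noteq> 0"
  shows "(pos_power (Suc m) has_field_derivative real (Suc m) * pos_power m x) (at x)"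
proof (cases "0 < x")
  case True
  have "((\<lambda>x. x ^ Suc m) has_field_derivative real (Suc m) * pos_power m x) (at x)"
    using True DERIV_power_Suc[OF DERIV_ident, of m x UNIV] by (simp add: pos_power_def)
  then show ?thesis
    by (rule has_field_derivative_transform_within_open[where S = "{0<..}"])
      (use True in \<open>auto simp: pos_power_def\<close>)
next
  case False
  have "((\<lambda>x. 0) has_field_derivative real (Suc m) * pos_power m x) (at x)"
    using False assms by (simp add: pos_power_def)
  then show ?thesis
    by (rule has_field_derivative_transform_within_open[where S = "{..<0}"])
      (use False assms in \<open>auto simp: pos_power_def\<close>)
qed

text \<open>
  For \<open>m = 0\<close> the integrand jumps at \<open>t = s\<close>, where the antiderivative has a kink; the fundamental
  theorem of calculus tolerates this exceptional point because the antiderivative is continuous.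
\<close>
lemma pos_power_has_integral:
  assumes "a \<le> b"
  shows "((\<lambda>t. pos_power m (s - t)) has_integral
    (pos_power (Suc m) (s - a) - pos_power (Suc m) (s - b)) / real (Suc m)) {a..b}"
proof -
  let ?F = "\<lambda>t. - pos_power (Suc m) (s - t) / real (Suc m)"
  have "((\<lambda>t. pos_power m (s - t)) has_integral ?F b - ?F a) {a..b}"
  proof (rule fundamental_theorem_of_calculus_interior_strong[where S = "{s}"])
    show "continuous_on {a..b} ?F" unfolding pos_power_Suc by (intro continuous_intros) auto
    fix t assume "t \<in> {a<..<b} - {s}"
    then have "(pos_power (Suc m) has_field_derivative real (Suc m) * pos_power m (s - t)) (at (s - t))"
      by (intro pos_power_has_derivative) auto
    moreover have "((\<lambda>t. s - t) has_field_derivative -1) (at t)"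
      by (auto intro!: derivative_eq_intros)
    ultimately have "((\<lambda>t. pos_power (Suc m) (s - t)) has_field_derivative
        real (Suc m) * pos_power m (s - t) * -1) (at t)"
      by (rule DERIV_chain2[where f = "pos_power (Suc m)" and g = "\<lambda>t. s - t" and x = t])
    then have "((\<lambda>t. pos_power (Suc m) (s - t)) has_field_derivative
        - (real (Suc m) * pos_power m (s - t))) (at t)" by simp
    from DERIV_cdivide[OF DERIV_minus[OF this], of "real (Suc m)"]
    have "(?F has_field_derivative pos_power m (s - t)) (at t)" by simp
    then show "(?F has_vector_derivative pos_power m (s - t)) (at t)"
      by (simp add: has_real_derivative_iff_has_vector_derivative)
  qed (use assms in auto)
  then show ?thesis by (simp add: diff_divide_distrib)
qed

text \<open>
  Pascal's rule: taking one more difference raises the order of an iterated difference by one.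
\<close>
lemma alternating_binomial_sum_diff:
  fixes Q :: "nat \<Rightarrow> real"
  shows "(\<Sum>j\<le>N. (-1) ^ j * real (N choose j) * (Q j - Q (Suc j)))
    = (\<Sum>j\<le>Suc N. (-1) ^ j * real (Suc N choose j) * Q j)"
proof -
  have "(\<Sum>j\<le>N. (-1) ^ j * real (N choose j) * Q j)
      = (\<Sum>j\<le>Suc N. (-1) ^ j * real (N choose j) * Q j)" by simp
  also have "\<dots> = Q 0 + (\<Sum>j\<le>N. (-1) ^ Suc j * real (N choose Suc j) * Q (Suc j))"
    by (subst sum.atMost_Suc_shift) simp
  finally have "(\<Sum>j\<le>N. (-1) ^ j * real (N choose j) * (Q j - Q (Suc j)))
      = Q 0 + (\<Sum>j\<le>N. (-1) ^ Suc j * real (N choose Suc j) * Q (Suc j))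
        - (\<Sum>j\<le>N. (-1) ^ j * real (N choose j) * Q (Suc j))"
    by (simp add: right_diff_distrib sum_subtractf)
  also have "\<dots> = Q 0 + (\<Sum>j\<le>N. (-1) ^ Suc j * real (Suc N choose Suc j) * Q (Suc j))"
    by (simp add: algebra_simps sum_subtractf sum.distrib sum_negf)
  also have "\<dots> = (\<Sum>j\<le>Suc N. (-1) ^ j * real (Suc N choose j) * Q j)"
    by (subst sum.atMost_Suc_shift) simp
  finally show ?thesis .
qed

text \<open>
  Convolution with the indicator of \<open>[a,1]\<close>. Each truncated power integrates to a difference of two
  truncated powers of the next degree whose arguments differ by \<open>1 - a\<close>, which is the step from \<open>j\<close>
  to \<open>j + 1\<close> in the sum.
\<close>
lemma irwin_hall_has_integral:
  assumes "a \<le> 1"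
  shows "((\<lambda>t. irwin_hall a m (s - t)) has_integral irwin_hall a (Suc m) s) {a..1}"
proof -
  define Q where "Q j = pos_power (Suc m) (s - real (Suc (Suc m)) * a - real j * (1 - a))" for j
  let ?c = "\<lambda>j. (-1) ^ j * real (Suc m choose j)"
  have "((\<lambda>t. pos_power m (s - t - real (Suc m) * a - real j * (1 - a))) has_integral
      (Q j - Q (Suc j)) / real (Suc m)) {a..1}" for j
    using pos_power_has_integral[OF assms, of m "s - real (Suc m) * a - real j * (1 - a)"]
    by (simp add: Q_def algebra_simps)
  then have "((\<lambda>t. irwin_hall a m (s - t)) has_integral
      1 / fact m * (\<Sum>j\<le>Suc m. ?c j * ((Q j - Q (Suc j)) / real (Suc m)))) {a..1}"
    unfolding irwin_hall_def by (intro has_integral_mult_right has_integral_sum) auto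
  also have "1 / fact m * (\<Sum>j\<le>Suc m. ?c j * ((Q j - Q (Suc j)) / real (Suc m)))
      = 1 / fact (Suc m) * (\<Sum>j\<le>Suc m. ?c j * (Q j - Q (Suc j)))"
    by (simp only: times_divide_eq_right sum_divide_distrib[symmetric] fact_Suc) simp
  also have "\<dots> = irwin_hall a (Suc m) s"
    unfolding alternating_binomial_sum_diff by (simp only: irwin_hall_def Q_def)
  finally show ?thesis .
qed

text \<open>
  The projection of the section of the cube \<open>[a,1)\<^sup>m\<^sup>+\<^sup>1\<close> by the hyperplane where the coordinates sum up
  to \<open>s\<close>. The level \<open>s\<close> is real and not only an integer, since the induction on \<open>m\<close> shifts it by real
  amounts.
\<close>
definition cube_section :: "real \<Rightarrow> nat \<Rightarrow> real \<Rightarrow> (nat \<Rightarrow> real) set" where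
  "cube_section a m s = {y \<in> {1..m} \<rightarrow>\<^sub>E {a..<1}. s - (\<Sum>i=1..m. y i) \<in> {a..<1}}"

lemma sets_cube_section: "cube_section a m s \<in> sets (lebesgue_cartesian m)"
proof -
  let ?f = "\<lambda>y :: nat \<Rightarrow> real. s - (\<Sum>i=1..m. y i)"
  have 1: "{1..m} \<rightarrow>\<^sub>E {a..<1} \<in> sets (lebesgue_cartesian m)"
    by (intro sets_PiM_I_finite) auto
  have "?f \<in> borel_measurable (lebesgue_cartesian m)"
    by (intro borel_measurable_diff borel_measurable_sum borel_measurable_const) simp
  then have 2: "?f -` {a..<1} \<inter> space (lebesgue_cartesian m) \<in> sets (lebesgue_cartesian m)"
    by (rule measurable_sets) simp
  have "cube_section a m s
      = ({1..m} \<rightarrow>\<^sub>E {a..<1}) \<inter> (?f -` {a..<1} \<inter> space (lebesgue_cartesian m))"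
    using sets.sets_into_space[OF 1] unfolding cube_section_def by blast
  then show ?thesis using sets.Int[OF 1 2] by (simp only:)
qed

text \<open>
  Fubini over the last of the \<open>m\<close> free coordinates reduces to the section at level \<open>s - t\<close> with one
  coordinate less. Nonnegativity is carried along since the measure is an extended nonnegative real.
\<close>
lemma cube_section_irwin_hall:
  assumes a: "a \<le> 1"
  shows "emeasure (lebesgue_cartesian m) (cube_section a m s) = ennreal (irwin_hall a m s)
    \<and> 0 \<le> irwin_hall a m s"
proof (induction m arbitrary: s)
  case 0
  have "irwin_hall a 0 s = pos_power 0 (s - a) - pos_power 0 (s - 1)"
    by (simp add: irwin_hall_def)
  also have "\<dots> = indicator {a..<1} s"
    using a by (simp add: pos_power_def indicator_def)
  finally have "irwin_hall a 0 s = indicator {a..<1} s" .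
  moreover have "cube_section a 0 s = (if s \<in> {a..<1} then {\<lambda>_. undefined} else {})"
    by (simp add: cube_section_def)
  ultimately show ?case by (simp add: PiM_empty indicator_def)
next
  case (Suc m)
  have I: "{1..Suc m} = insert (Suc m) {1..m}" by auto
  have IH: "emeasure (lebesgue_cartesian m) (cube_section a m t) = ennreal (irwin_hall a m t)"
    "0 \<le> irwin_hall a m t" for t
    using Suc.IH[of t] by simp_all
  have nonneg: "0 \<le> irwin_hall a (Suc m) s"
    using irwin_hall_has_integral[OF a] IH(2) by (rule has_integral_nonneg)
  have ind: "indicator (cube_section a (Suc m) s) (y(Suc m := t))
      = (indicator {a..<1} t * indicator (cube_section a m (s - t)) y :: ennreal)"
    if "y \<in> euclid m" for y t
  proof -
    have "y(Suc m := t) \<in> {1..Suc m} \<rightarrow>\<^sub>E {a..<1}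
        \<longleftrightarrow> t \<in> {a..<1} \<and> (\<forall>i\<in>{1..m}. y i \<in> {a..<1})"
    proof -
      have "y(Suc m := t) \<in> extensional {1..Suc m}"
        using that by (auto simp: euclid_def PiE_iff extensional_def)
      then show ?thesis by (simp add: PiE_iff I)
    qed
    also have "\<dots> \<longleftrightarrow> t \<in> {a..<1} \<and> y \<in> {1..m} \<rightarrow>\<^sub>E {a..<1}"
      using that by (simp add: PiE_iff euclid_def)
    finally have "y(Suc m := t) \<in> cube_section a (Suc m) s
        \<longleftrightarrow> t \<in> {a..<1} \<and> y \<in> cube_section a m (s - t)"
      unfolding cube_section_def by (simp add: diff_diff_eq add.commute)
    then show ?thesis by (simp add: indicator_def)
  qed
  have "emeasure (lebesgue_cartesian (Suc m)) (cube_section a (Suc m) s)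
      = (\<integral>\<^sup>+ x. indicator (cube_section a (Suc m) s) x \<partial>lebesgue_cartesian (Suc m))"
    by (simp add: sets_cube_section)
  also have "\<dots> = (\<integral>\<^sup>+ t. (\<integral>\<^sup>+ y. indicator (cube_section a (Suc m) s) (y(Suc m := t))
      \<partial>lebesgue_cartesian m) \<partial>lborel)"
    unfolding I
  proof (rule lborel_product.product_nn_integral_insert_rev)
    show "indicator (cube_section a (Suc m) s)
        \<in> borel_measurable (Pi\<^sub>M (insert (Suc m) {1..m}) (\<lambda>_. lborel))"
      using sets_cube_section[of a "Suc m" s] unfolding I by (rule borel_measurable_indicator)
  qed auto
  also have "\<dots> = (\<integral>\<^sup>+ t. (\<integral>\<^sup>+ y. indicator {a..<1} t * indicator (cube_section a m (s - t)) y
      \<partial>lebesgue_cartesian m) \<partial>lborel)"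
    by (intro nn_integral_cong) (simp add: ind)
  also have "\<dots> = (\<integral>\<^sup>+ t. ennreal (irwin_hall a m (s - t)) * indicator {a..<1} t \<partial>lborel)"
    by (simp only: nn_integral_cmult_indicator sets_cube_section IH(1) mult.commute)
  also have "\<dots> = (\<integral>\<^sup>+ t. ennreal (irwin_hall a m (s - t)) * indicator {a..1} t \<partial>lborel)"
    using AE_lborel_singleton[of 1]
    by (intro nn_integral_cong_AE, eventually_elim) (auto simp: indicator_def)
  also have "\<dots> = ennreal (irwin_hall a (Suc m) s)"
    using IH(2) irwin_hall_has_integral[OF a] by (rule nn_integral_has_integral_lebesgue')
  finally show ?case using nonneg by simp
qed

text \<open>
  For \<open>y \<in> [0,1)\<^sup>m\<close> there is exactly one integer \<open>k\<close> with \<open>k - \<Sum> y \<in> [0,1)\<close>, namely the ceiling of the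
  sum, and it lies in \<open>{0..m}\<close>. So the sections tile the cube.
\<close>
lemma sum_irwin_hall_0: "(\<Sum>k<Suc m. irwin_hall 0 m (real k)) = 1"
proof -
  let ?L = "lebesgue_cartesian m"
  have "(\<Union>k<Suc m. cube_section 0 m (real k)) = {1..m} \<rightarrow>\<^sub>E {0..<1}"
  proof
    show "{1..m} \<rightarrow>\<^sub>E {0..<1} \<subseteq> (\<Union>k<Suc m. cube_section 0 m (real k))"
    proof
      fix y :: "nat \<Rightarrow> real" assume y: "y \<in> {1..m} \<rightarrow>\<^sub>E {0..<1}"
      let ?s = "\<Sum>i=1..m. y i"
      have yi: "0 \<le> y i \<and> y i \<le> 1" if "i \<in> {1..m}" for i using PiE_mem[OF y that] by simp
      then have s: "0 \<le> ?s" "?s \<le> real m"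
        using sum_bounded_above[of "{1..m}" y 1] by (auto intro!: sum_nonneg)
      then have c: "0 \<le> \<lceil>?s\<rceil>" "\<lceil>?s\<rceil> \<le> int m" by linarith+
      have "real (nat \<lceil>?s\<rceil>) = real_of_int \<lceil>?s\<rceil>" using c by simp
      then have "0 \<le> real (nat \<lceil>?s\<rceil>) - ?s" "real (nat \<lceil>?s\<rceil>) - ?s < 1" by linarith+
      then have "y \<in> cube_section 0 m (real (nat \<lceil>?s\<rceil>))" using y by (simp add: cube_section_def)
      moreover have "nat \<lceil>?s\<rceil> < Suc m" using c by linarith
      ultimately show "y \<in> (\<Union>k<Suc m. cube_section 0 m (real k))" by blast
    qed
  qed (auto simp: cube_section_def)
  moreover have "emeasure ?L ({1..m} \<rightarrow>\<^sub>E {0..<1}) = 1"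
    by (subst lborel_product.emeasure_PiM) auto
  moreover have "disjoint_family_on (\<lambda>k. cube_section 0 m (real k)) {..<Suc m}"
    by (auto simp: disjoint_family_on_def cube_section_def)
  then have "(\<Sum>k<Suc m. emeasure ?L (cube_section 0 m (real k)))
      = emeasure ?L (\<Union>k<Suc m. cube_section 0 m (real k))"
    by (intro sum_emeasure) (auto simp: sets_cube_section)
  ultimately have "ennreal (\<Sum>k<Suc m. irwin_hall 0 m (real k)) = ennreal 1"
    using cube_section_irwin_hall[of 0 m] by (simp add: sum_ennreal del: sum.lessThan_Suc)
  then show ?thesis
    using cube_section_irwin_hall[of 0 m]
    by (subst (asm) ennreal_inj) (auto intro!: sum_nonneg simp del: sum.lessThan_Suc)
qed

text \<open>
  Substituting \<open>i = n - j\<close>, and then \<open>k + i - n\<close> for \<open>k\<close>, turns the arguments of the truncated powers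
  into \<open>k - i a\<close> with \<open>k\<close> ranging over \<open>i - n, \<dots>, i - 1\<close>. The terms missing on the right-hand side
  vanish: a nonzero term has \<open>k > i a \<ge> 0\<close>, hence \<open>i \<ge> k + 1 \<ge> 2\<close> and \<open>k \<ge> 1 \<ge> i - n + 1\<close>.
\<close>
lemma sum_irwin_hall:
  assumes m: "m \<ge> 1" and a: "0 \<le> a"
  defines "n \<equiv> Suc m"
  shows "(\<Sum>k<n. irwin_hall a m (real k)) = 1 / fact m *
      (\<Sum>(i, k) \<in> {(i :: nat, k :: int). 2 \<le> i \<and> i \<le> n \<and>
            max (real i * a) (real i - real n + 1) \<le> real_of_int k \<and> k \<le> int i - 1}.
         (-1) ^ (n + i) * real (n choose i) * (real_of_int k - real i * a) ^ m)"
proof -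
  let ?P = "{(i :: nat, k :: int). 2 \<le> i \<and> i \<le> n \<and>
            max (real i * a) (real i - real n + 1) \<le> real_of_int k \<and> k \<le> int i - 1}"
  let ?Q = "SIGMA i:{..n}. {int i - int n..int i - 1}"
  let ?c = "\<lambda>i. (-1) ^ (n + i) * real (n choose i)"
  have "(\<Sum>(i, k) \<in> ?P. ?c i * (real_of_int k - real i * a) ^ m)
      = (\<Sum>(i, k) \<in> ?Q. ?c i * pos_power m (real_of_int k - real i * a))"
  proof (rule sum.mono_neutral_cong_left)
    show "finite ?Q" by auto
    show "?P \<subseteq> ?Q" by auto
    show "\<forall>p\<in>?Q - ?P. (case p of (i, k) \<Rightarrow> ?c i * pos_power m (real_of_int k - real i * a)) = 0"
    proof
      fix p assume "p \<in> ?Q - ?P"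
      then obtain i k where p: "p = (i, k)"
        and ik: "i \<le> n" "k \<in> {int i - int n..int i - 1}" "(i, k) \<notin> ?P"
        by (cases p) auto
      have "pos_power m (real_of_int k - real i * a) = 0"
      proof (cases "real i * a < real_of_int k")
        case False
        \<comment> \<open>For \<open>k = i a\<close> this is \<open>0\<^sup>m\<close>, which vanishes only because \<open>m \<ge> 1\<close>.\<close>
        then show ?thesis using m by (auto simp: pos_power_def)
      next
        case True
        then have "0 < real_of_int k" using a mult_nonneg_nonneg[of "real i" a] by linarith
        then have "0 < k" by simp
        then have "(i, k) \<in> ?P" using ik(1,2) True by auto
        then show ?thesis using ik by simp
      qed
      then show "(case p of (i, k) \<Rightarrow> ?c i * pos_power m (real_of_int k - real i * a)) = 0"
        by (simp add: p)
    qed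
  qed (auto simp: pos_power_def)
  also have "\<dots> = (\<Sum>i\<le>n. \<Sum>k\<in>{int i - int n..int i - 1}. ?c i * pos_power m (real_of_int k - real i * a))"
    by (rule sum.Sigma[symmetric]) auto
  also have "\<dots> = (\<Sum>i\<le>n. \<Sum>k<n. ?c i * pos_power m (real k - real n + real i - real i * a))"
  proof (rule sum.cong[OF refl])
    fix i
    show "(\<Sum>k\<in>{int i - int n..int i - 1}. ?c i * pos_power m (real_of_int k - real i * a))
      = (\<Sum>k<n. ?c i * pos_power m (real k - real n + real i - real i * a))"
      by (rule sum.reindex_bij_witness[where i = "\<lambda>k. int k - int n + int i"
            and j = "\<lambda>k. nat (k + int n - int i)"]) auto
  qed
  also have "\<dots> = (\<Sum>k<n. \<Sum>i\<le>n. ?c i * pos_power m (real k - real n + real i - real i * a))"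
    by (rule sum.swap)
  also have "\<dots> = (\<Sum>k<n. \<Sum>j\<le>n. (-1) ^ j * real (n choose j)
      * pos_power m (real k - real n * a - real j * (1 - a)))"
  proof (rule sum.cong[OF refl])
    fix k
    show "(\<Sum>i\<le>n. ?c i * pos_power m (real k - real n + real i - real i * a))
      = (\<Sum>j\<le>n. (-1) ^ j * real (n choose j) * pos_power m (real k - real n * a - real j * (1 - a)))"
    proof (rule sum.reindex_bij_witness[where i = "\<lambda>j. n - j" and j = "\<lambda>i. n - i"])
      fix i assume "i \<in> {..n}"
      then have i: "i \<le> n" by simp
      have "(-1) ^ (n + i) = ((-1) ^ (n - i) :: real)"
        using i by (simp add: minus_one_power_iff)
      moreover have "n choose (n - i) = n choose i" using i by (rule binomial_symmetric[symmetric])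
      moreover have "real k - real n * a - real (n - i) * (1 - a) = real k - real n + real i - real i * a"
        using i by (simp add: of_nat_diff algebra_simps)
      ultimately show "(-1) ^ (n - i) * real (n choose (n - i))
          * pos_power m (real k - real n * a - real (n - i) * (1 - a))
        = ?c i * pos_power m (real k - real n + real i - real i * a)" by (simp only:)
    qed auto
  qed
  finally show ?thesis by (simp add: irwin_hall_def n_def sum_distrib_left del: sum.lessThan_Suc sum.atMost_Suc)
qed

section \<open>Symmetrisation over the permutations of the coordinates\<close>

text \<open>
  The section of the cube \<open>[a,1)\<^sup>n\<close> by the hyperplane at level \<open>k\<close>; its projection is \<open>cube_section\<close>.
\<close>
definition cube_slice :: "real \<Rightarrow> nat \<Rightarrow> nat \<Rightarrow> (nat \<Rightarrow> real) set" where
  "cube_slice a n k = {x \<in> hyperplane n k. \<forall>i\<in>{1..n}. a \<le> x i \<and> x i < 1}"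

lemma cube_slice_subset: "cube_slice a n k \<subseteq> euclid n"
  by (auto simp: cube_slice_def hyperplane_def)

lemma cube_slice_eq_over: "cube_slice a (Suc m) k = over m k (cube_section a m (real k))"
proof -
  have "x \<in> cube_slice a (Suc m) k \<longleftrightarrow> x \<in> over m k (cube_section a m (real k))"
    if x: "x \<in> hyperplane (Suc m) k" for x
  proof -
    have I: "{1..Suc m} = insert (Suc m) {1..m}" by auto
    have "x (Suc m) = real k - (\<Sum>i=1..m. x i)" using x by (simp add: hyperplane_def)
    then show ?thesis using x by (auto simp: cube_slice_def over_def cube_section_def I)
  qed
  moreover have "cube_slice a (Suc m) k \<subseteq> hyperplane (Suc m) k"
    "over m k (cube_section a m (real k)) \<subseteq> hyperplane (Suc m) k"
    by (auto simp: cube_slice_def over_def)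
  ultimately show ?thesis by blast
qed

lemma sets_Collect_coords_le:
  assumes "i \<in> {1..n}" "j \<in> {1..n}"
  shows "{x \<in> euclid n. x i \<le> x j} \<in> sets (lebesgue_cartesian n)"
proof -
  have "{x \<in> space (lebesgue_cartesian n). x i \<le> x j} \<in> sets (lebesgue_cartesian n)"
    using assms by (intro borel_measurable_le) auto
  then show ?thesis by simp
qed

lemma sets_image_translate:
  assumes S: "S \<in> sets (lebesgue_cartesian n)"
  shows "translate n v ` S \<in> sets (lebesgue_cartesian n)"
proof -
  have Se: "S \<subseteq> euclid n" using sets.sets_into_space[OF S] by simp
  have "translate n v ` S = translate n (\<lambda>i. - v i) -` S \<inter> space (lebesgue_cartesian n)"
  proof
    show "translate n v ` S \<subseteq> translate n (\<lambda>i. - v i) -` S \<inter> space (lebesgue_cartesian n)"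
      using Se by (auto simp: translate_inverse subset_eq)
    show "translate n (\<lambda>i. - v i) -` S \<inter> space (lebesgue_cartesian n) \<subseteq> translate n v ` S"
    proof
      fix x assume "x \<in> translate n (\<lambda>i. - v i) -` S \<inter> space (lebesgue_cartesian n)"
      then have "translate n (\<lambda>i. - v i) x \<in> S" "x = translate n v (translate n (\<lambda>i. - v i) x)"
        by (auto simp: translate_inverse)
      then show "x \<in> translate n v ` S" by blast
    qed
  qed
  also have "\<dots> \<in> sets (lebesgue_cartesian n)"
    using S by (intro measurable_sets[OF measurable_translate]) auto
  finally show ?thesis .
qed

lemma sets_image_permute_coords:
  assumes p: "p permutes {1..n}" and S: "S \<in> sets (lebesgue_cartesian n)"
  shows "permute_coords n p ` S \<in> sets (lebesgue_cartesian n)"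
proof -
  have Se: "S \<subseteq> euclid n" using sets.sets_into_space[OF S] by simp
  have "permute_coords n p ` S = permute_coords n (inv p) -` S \<inter> space (lebesgue_cartesian n)"
  proof
    show "permute_coords n p ` S \<subseteq> permute_coords n (inv p) -` S \<inter> space (lebesgue_cartesian n)"
      using Se by (auto simp: permute_coords_inverse[OF p] subset_eq)
    show "permute_coords n (inv p) -` S \<inter> space (lebesgue_cartesian n) \<subseteq> permute_coords n p ` S"
    proof
      fix x assume "x \<in> permute_coords n (inv p) -` S \<inter> space (lebesgue_cartesian n)"
      then have "permute_coords n (inv p) x \<in> S" "x = permute_coords n p (permute_coords n (inv p) x)"
        by (auto simp: permute_coords_inverse[OF p])
      then show "x \<in> permute_coords n p ` S" by blast
    qed
  qed
  also have "\<dots> \<in> sets (lebesgue_cartesian n)"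
  proof (rule measurable_sets[OF _ S])
    show "permute_coords n (inv p) \<in> measurable (lebesgue_cartesian n) (lebesgue_cartesian n)"
      unfolding permute_coords_def using permutes_in_image[OF permutes_inv[OF p]]
      by (intro measurable_restrict) (auto simp del: atLeastAtMost_iff)
  qed
  finally show ?thesis .
qed

lemma sets_cube_slice: "cube_slice a (Suc m) k \<in> sets (lebesgue_cartesian (Suc m))"
  unfolding cube_slice_eq_over by (intro sets_over sets_cube_section)

definition diagonal_part :: "real \<Rightarrow> nat \<Rightarrow> nat \<Rightarrow> nat \<Rightarrow> nat \<Rightarrow> (nat \<Rightarrow> real) set" where
  "diagonal_part a n k i j = {x \<in> cube_slice a n k. x i = x j}"

lemma sets_diagonal_part:
  assumes "i \<in> {1..Suc m}" "j \<in> {1..Suc m}"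
  shows "diagonal_part a (Suc m) k i j \<in> sets (lebesgue_cartesian (Suc m))"
proof -
  have "diagonal_part a (Suc m) k i j = cube_slice a (Suc m) k
      \<inter> ({x \<in> euclid (Suc m). x i \<le> x j} \<inter> {x \<in> euclid (Suc m). x j \<le> x i})"
    using cube_slice_subset by (auto simp: diagonal_part_def)
  then show ?thesis
    using sets_cube_slice assms by (simp only: sets.Int sets_Collect_coords_le)
qed

text \<open>
  Translations by multiples of the \<open>i\<close>-th minus the \<open>j\<close>-th unit vector preserve the hyperplane and
  take the diagonal \<open>x\<^sub>i = x\<^sub>j\<close> to the sets where \<open>x\<^sub>i - x\<^sub>j\<close> has a given value. So there are infinitely
  many disjoint isometric copies of the set within a bounded part of the hyperplane, which has finite
  measure.
\<close>
lemma hausdorff_diagonal_part: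
  assumes a: "0 \<le> a" and ij: "i \<in> {1..Suc m}" "j \<in> {1..Suc m}" "i \<noteq> j"
  shows "hausdorff_codim1 (Suc m) (diagonal_part a (Suc m) k i j) = 0"
proof -
  let ?Z = "diagonal_part a (Suc m) k i j" and ?H = "hausdorff_codim1 (Suc m)"
  define v where "v p = (\<lambda>l. if l = i then 1 / real (Suc p) else if l = j then - 1 / real (Suc p) else 0)"
    for p :: nat
  define T where "T p = translate (Suc m) (v p) ` ?Z" for p
  have Z: "?Z \<in> sets (lebesgue_cartesian (Suc m))" by (rule sets_diagonal_part[OF ij(1,2)])
  have T: "T p \<in> sets (lebesgue_cartesian (Suc m))" for p
    unfolding T_def by (rule sets_image_translate[OF Z])
  have HT: "?H (T p) = ?H ?Z" for p
    unfolding T_def using cube_slice_subset by (intro hausdorff_translate) (auto simp: diagonal_part_def)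
  have sumv: "(\<Sum>l=1..Suc m. v p l) = 0" for p
  proof -
    have "(\<Sum>l=1..Suc m. v p l) = (\<Sum>l=1..Suc m. (if l = i then 1 / real (Suc p) else 0)
        + (if l = j then - 1 / real (Suc p) else 0))"
      using ij by (intro sum.cong) (auto simp: v_def)
    also have "\<dots> = 0" using ij by (simp only: sum.distrib sum.delta finite_atLeastAtMost) simp
    finally show ?thesis .
  qed
  have big: "T p \<subseteq> over m k ({1..m} \<rightarrow>\<^sub>E {-2..<2})" for p
  proof
    fix x assume "x \<in> T p"
    then obtain z where z: "z \<in> ?Z" "x = translate (Suc m) (v p) z" by (auto simp: T_def)
    have "\<bar>v p l\<bar> \<le> 1" for l by (auto simp: v_def)
    moreover have "0 \<le> z l \<and> z l < 1" if "l \<in> {1..Suc m}" for l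
    proof -
      have "a \<le> z l \<and> z l < 1" using z(1) that unfolding diagonal_part_def cube_slice_def by blast
      then show ?thesis using a by simp
    qed
    ultimately have xl: "-2 \<le> x l \<and> x l < 2" if "l \<in> {1..m}" for l
      using that z(2) abs_le_D1[of "v p l" 1] abs_le_D2[of "v p l" 1]
      by (fastforce simp: translate_def)
    have "(\<Sum>l=1..Suc m. x l) = (\<Sum>l=1..Suc m. z l) + (\<Sum>l=1..Suc m. v p l)"
      unfolding sum.distrib[symmetric] z(2) by (intro sum.cong) (auto simp: translate_def)
    then have "x \<in> hyperplane (Suc m) k"
      using z by (simp add: sumv hyperplane_def diagonal_part_def cube_slice_def del: sum.cl_ivl_Suc)
    then show "x \<in> over m k ({1..m} \<rightarrow>\<^sub>E {-2..<2})" using xl by (auto simp: over_def)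
  qed
  have disj: "T p \<inter> T q = {}" if "p \<noteq> q" for p q
  proof -
    have "x i - x j = 2 / real (Suc p)" if "x \<in> T p" for x p
      using that ij by (auto simp: T_def translate_def v_def diagonal_part_def)
    note diff = this
    show ?thesis
    proof (rule ccontr)
      assume "\<not> ?thesis"
      then obtain x where "x \<in> T p" "x \<in> T q" by blast
      then have "2 / real (Suc p) = 2 / real (Suc q)" using diff by metis
      then show False using that by simp
    qed
  qed
  have "of_nat N * ?H ?Z \<le> ?H (over m k ({1..m} \<rightarrow>\<^sub>E {-2..<2}))" for N
  proof -
    have "of_nat N * ?H ?Z = (\<Sum>p<N. emeasure (surface_measure (Suc m)) (T p))"
      by (simp only: emeasure_surface_measure T HT sum_constant card_lessThan)
    also have "\<dots> = emeasure (surface_measure (Suc m)) (\<Union>p<N. T p)"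
      using T disj by (intro sum_emeasure) (auto simp: disjoint_family_on_def)
    also have "\<dots> = ?H (\<Union>p<N. T p)" using T by (intro emeasure_surface_measure) auto
    also have "\<dots> \<le> ?H (over m k ({1..m} \<rightarrow>\<^sub>E {-2..<2}))"
      using big by (intro hausdorff_measure_mono) auto
    finally show ?thesis .
  qed
  note bound = this
  have fin: "?H (over m k ({1..m} \<rightarrow>\<^sub>E {-2..<2})) < top" by (rule hausdorff_over_cube_finite) simp
  then obtain b where b: "0 \<le> b" "?H (over m k ({1..m} \<rightarrow>\<^sub>E {-2..<2})) = ennreal b"
    by (cases "?H (over m k ({1..m} \<rightarrow>\<^sub>E {-2..<2}))") auto
  have "?H ?Z < top" using bound[of 1] fin by (simp add: le_less_trans)
  then obtain h where h: "0 \<le> h" "?H ?Z = ennreal h" by (cases "?H ?Z") auto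
  have "real N * h \<le> b" for N
    using bound[of N] h b
    by (simp add: ennreal_of_nat_eq_real_of_nat ennreal_mult'[symmetric] ennreal_le_iff)
  then have "\<not> 0 < h" using reals_Archimedean3[of h] by (meson not_le)
  then show ?thesis using h by simp
qed

definition strictly_sorted_slice :: "real \<Rightarrow> nat \<Rightarrow> nat \<Rightarrow> (nat \<Rightarrow> real) set" where
  "strictly_sorted_slice a n k = {x \<in> cube_slice a n k. strict_mono_on {1..n} x}"

definition sorted_slice :: "real \<Rightarrow> nat \<Rightarrow> nat \<Rightarrow> (nat \<Rightarrow> real) set" where
  "sorted_slice a n k = {x \<in> cube_slice a n k. mono_on {1..n} x}"

text \<open>
  The positions, sorted by their values; they form a permutation, and the sorted values are strictly
  increasing since they are distinct.
\<close>
lemma ex_sorting_permutation: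
  fixes x :: "nat \<Rightarrow> real"
  assumes "inj_on x {1..n}"
  obtains p where "p permutes {1..n}" "strict_mono_on {1..n} (x \<circ> p)"
proof -
  define zs where "zs = sort_key x [1..<Suc n]"
  have zs: "set zs = {1..n}" "distinct zs" "length zs = n" by (auto simp: zs_def)
  have "sorted (map x zs)" by (simp add: zs_def)
  moreover have "distinct (map x zs)" using assms zs by (simp add: distinct_map)
  ultimately have ss: "sorted_wrt (<) (map x zs)" by (simp add: strict_sorted_iff)
  define p where "p i = (if i \<in> {1..n} then zs ! (i - 1) else i)" for i
  have "bij_betw (\<lambda>i. i - 1) {1..n} {..<n}"
    by (rule bij_betw_byWitness[where f' = Suc]) auto
  moreover have "bij_betw ((!) zs) {..<n} {1..n}"
    using bij_betw_nth[OF zs(2), of "{..<n}" "{1..n}"] zs by simp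
  ultimately have "bij_betw ((!) zs \<circ> (\<lambda>i. i - 1)) {1..n} {1..n}" by (rule bij_betw_trans)
  then have "bij_betw p {1..n} {1..n}"
    by (rule bij_betw_cong[THEN iffD1, rotated]) (simp add: p_def)
  then have "p permutes {1..n}" by (rule bij_imp_permutes) (auto simp: p_def)
  moreover have "strict_mono_on {1..n} (x \<circ> p)"
  proof (rule strict_mono_onI)
    fix r s assume "r \<in> {1..n}" "s \<in> {1..n}" "r < s"
    then show "(x \<circ> p) r < (x \<circ> p) s"
      using sorted_wrt_nth_less[OF ss, of "r - 1" "s - 1"] zs(3) by (simp add: p_def)
  qed
  ultimately show ?thesis by (rule that)
qed

lemma sorting_permutation_unique:
  fixes x :: "nat \<Rightarrow> real"
  assumes p: "p permutes {1..n}" "strict_mono_on {1..n} (x \<circ> p)"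
    and q: "q permutes {1..n}" "strict_mono_on {1..n} (x \<circ> q)"
  shows "p = q"
proof -
  have ss: "sorted_wrt (<) (map (x \<circ> r) [1..<Suc n])" if "strict_mono_on {1..n} (x \<circ> r)" for r
    using that unfolding sorted_wrt_map
    by (intro sorted_wrt_mono_rel[OF _ sorted_wrt_upt]) (auto simp: strict_mono_on_def)
  have st: "set (map (x \<circ> r) [1..<Suc n]) = x ` {1..n}" if "r permutes {1..n}" for r
  proof -
    have "set [1..<Suc n] = {1..n}" by auto
    then show ?thesis using permutes_image[OF that] by (simp only: set_map image_comp[symmetric])
  qed
  have "map (x \<circ> p) [1..<Suc n] = map (x \<circ> q) [1..<Suc n]"
    using ss[OF p(2)] ss[OF q(2)] st[OF p(1)] st[OF q(1)]
    by (intro strict_sorted_equal) auto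
  then have eq: "x (p i) = x (q i)" if "i \<in> {1..n}" for i
    using that by (auto simp del: upt_Suc)
  have "inj_on (x \<circ> p) {1..n}" by (rule strict_mono_on_imp_inj_on[OF p(2)])
  then have inj: "inj_on x {1..n}"
    using permutes_image[OF p(1)] permutes_inj_on[OF p(1)] by (metis inj_on_imageI)
  show "p = q"
  proof
    fix i show "p i = q i"
    proof (cases "i \<in> {1..n}")
      case True
      then show ?thesis
        using inj_onD[OF inj eq[OF True]] permutes_in_image[OF p(1)] permutes_in_image[OF q(1)] by blast
    next
      case False
      then show ?thesis using permutes_not_in[OF p(1)] permutes_not_in[OF q(1)] by metis
    qed
  qed
qed

lemma cube_slice_permute_coords:
  assumes p: "p permutes {1..n}" and x: "x \<in> cube_slice a n k"
  shows "permute_coords n p x \<in> cube_slice a n k"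
proof -
  have "(\<Sum>i=1..n. x (p i)) = (\<Sum>i=1..n. x i)"
    using sum.permute[OF p, of x] by (simp add: o_def)
  then show ?thesis
    using x permutes_in_image[OF p]
    by (simp add: cube_slice_def hyperplane_def del: atLeastAtMost_iff)
      (simp add: permute_coords_def del: atLeastAtMost_iff)
qed

lemma sets_strictly_sorted_slice:
  "strictly_sorted_slice a (Suc m) k \<in> sets (lebesgue_cartesian (Suc m))"
proof -
  let ?L = "lebesgue_cartesian (Suc m)" and ?I = "{1..Suc m}"
  have "x \<in> strictly_sorted_slice a (Suc m) k \<longleftrightarrow> x \<in> cube_slice a (Suc m) k
      - (\<Union>i\<in>?I. \<Union>j\<in>{j\<in>?I. i < j}. {x \<in> euclid (Suc m). x j \<le> x i})" for x
    using cube_slice_subset[of a "Suc m" k]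
    unfolding strictly_sorted_slice_def strict_mono_on_def not_le[symmetric] by blast
  then have "strictly_sorted_slice a (Suc m) k = cube_slice a (Suc m) k
      - (\<Union>i\<in>?I. \<Union>j\<in>{j\<in>?I. i < j}. {x \<in> euclid (Suc m). x j \<le> x i})" by blast
  also have "\<dots> \<in> sets ?L"
    by (intro sets.Diff sets_cube_slice sets.finite_UN sets_Collect_coords_le) auto
  finally show ?thesis .
qed

text \<open>
  The symmetrisation. Outside the null set \<open>D\<close> of points with two equal coordinates, each point is
  the image of exactly one strictly sorted point under exactly one permutation. The sorted and the
  strictly sorted points differ only within \<open>D\<close>.
\<close>
lemma hausdorff_cube_slice:
  assumes a: "0 \<le> a"
  shows "hausdorff_codim1 (Suc m) (cube_slice a (Suc m) k)
    = of_nat (fact (Suc m)) * hausdorff_codim1 (Suc m) (sorted_slice a (Suc m) k)"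
proof -
  let ?n = "Suc m" let ?I = "{1..?n}" and ?M = "surface_measure ?n"
  let ?S = "strictly_sorted_slice a ?n k" and ?H = "hausdorff_codim1 ?n"
  let ?P = "{p. p permutes ?I}"
  define D where "D = (\<Union>i\<in>?I. \<Union>j\<in>?I - {i}. diagonal_part a ?n k i j)"
  have "diagonal_part a ?n k i j \<in> null_sets ?M" if "i \<in> ?I" "j \<in> ?I - {i}" for i j
    using that sets_diagonal_part[of i m j a k] hausdorff_diagonal_part[OF a, of i m j k]
    by (simp add: null_sets_def emeasure_surface_measure del: atLeastAtMost_iff)
  then have D: "D \<in> null_sets ?M" unfolding D_def by (intro null_sets.finite_UN) auto
  have S: "?S \<in> sets (lebesgue_cartesian ?n)" by (rule sets_strictly_sorted_slice)
  have Se: "?S \<subseteq> euclid ?n" using sets.sets_into_space[OF S] by simp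
  have P: "permute_coords ?n p ` ?S \<in> sets (lebesgue_cartesian ?n)" if "p permutes ?I" for p
    using that S by (rule sets_image_permute_coords)
  have nD: "inj_on x ?I" if "x \<in> cube_slice a ?n k" "x \<notin> D" for x
  proof (rule inj_onI, rule ccontr)
    fix i j assume ij: "i \<in> ?I" "j \<in> ?I" "x i = x j" "i \<noteq> j"
    then have "x \<in> diagonal_part a ?n k i j" using that(1) by (simp only: diagonal_part_def mem_Collect_eq)
    then show False using ij that(2) unfolding D_def by blast
  qed
  have cover: "cube_slice a ?n k \<union> D = (\<Union>p\<in>?P. permute_coords ?n p ` ?S) \<union> D"
  proof -
    have "x \<in> (\<Union>p\<in>?P. permute_coords ?n p ` ?S)" if x: "x \<in> cube_slice a ?n k" "x \<notin> D" for x
    proof -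
      obtain p where p: "p permutes ?I" "strict_mono_on ?I (x \<circ> p)"
        using ex_sorting_permutation[OF nD[OF x]] .
      have "strict_mono_on ?I (permute_coords ?n p x)"
        using p(2) by (simp add: strict_mono_on_def permute_coords_def)
      then have "permute_coords ?n p x \<in> ?S"
        using cube_slice_permute_coords[OF p(1) x(1)] by (simp add: strictly_sorted_slice_def)
      moreover have "x = permute_coords ?n (inv p) (permute_coords ?n p x)"
        using permute_coords_inverse(1)[OF p(1)] x(1) cube_slice_subset by force
      ultimately show ?thesis using permutes_inv[OF p(1)] by blast
    qed
    moreover have "(\<Union>p\<in>?P. permute_coords ?n p ` ?S) \<subseteq> cube_slice a ?n k"
      using cube_slice_permute_coords by (auto simp: strictly_sorted_slice_def)
    ultimately show ?thesis by blast
  qed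
  have disj: "disjoint_family_on (\<lambda>p. permute_coords ?n p ` ?S) ?P"
    unfolding disjoint_family_on_def
  proof (intro ballI impI)
    fix p q assume pq: "p \<in> ?P" "q \<in> ?P" "p \<noteq> q"
    have sorts: "strict_mono_on ?I (x \<circ> inv r)" if "r \<in> ?P" "x \<in> permute_coords ?n r ` ?S" for x r
    proof -
      from that obtain z where z: "z \<in> ?S" "x = permute_coords ?n r z" by blast
      have "permute_coords ?n (inv r) x = z"
        using permute_coords_inverse(1)[of r ?n z] that(1) z Se by blast
      then have "strict_mono_on ?I (permute_coords ?n (inv r) x)"
        using z by (simp add: strictly_sorted_slice_def)
      then show ?thesis by (simp add: strict_mono_on_def permute_coords_def)
    qed
    show "permute_coords ?n p ` ?S \<inter> permute_coords ?n q ` ?S = {}"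
    proof (rule ccontr)
      assume "\<not> ?thesis"
      then obtain x where "x \<in> permute_coords ?n p ` ?S" "x \<in> permute_coords ?n q ` ?S" by blast
      then have "inv p = inv q"
        using pq sorts by (intro sorting_permutation_unique[of _ ?n x]) (auto intro: permutes_inv)
      then have "p = q" using pq(1,2) permutes_inv_inv by (metis mem_Collect_eq)
      then show False using pq(3) by contradiction
    qed
  qed
  have "?H (cube_slice a ?n k) = emeasure ?M (cube_slice a ?n k \<union> D)"
    using D sets_cube_slice[of a m k] by (simp add: emeasure_Un_null_set emeasure_surface_measure)
  also have "\<dots> = emeasure ?M (\<Union>p\<in>?P. permute_coords ?n p ` ?S)"
    unfolding cover using D P finite_permutations[of ?I]
    by (intro emeasure_Un_null_set) (auto intro!: sets.finite_UN)
  also have "\<dots> = (\<Sum>p\<in>?P. emeasure ?M (permute_coords ?n p ` ?S))"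
    using P disj finite_permutations[of ?I] by (intro sum_emeasure[symmetric]) auto
  also have "\<dots> = (\<Sum>p\<in>?P. ?H ?S)"
    using P Se
    by (intro sum.cong refl)
      (simp only: emeasure_surface_measure hausdorff_permute_coords mem_Collect_eq)
  also have "\<dots> = of_nat (fact ?n) * ?H ?S"
    using card_permutations[of ?I ?n] by simp
  also have "?H ?S = ?H (sorted_slice a ?n k)"
  proof (rule antisym)
    show "?H ?S \<le> ?H (sorted_slice a ?n k)"
      by (intro hausdorff_measure_mono)
        (auto simp: strictly_sorted_slice_def sorted_slice_def strict_mono_on_imp_mono_on)
    have "x \<in> ?S \<union> D" if x: "x \<in> sorted_slice a ?n k" for x
    proof (cases "x \<in> D")
      case False
      then have "inj_on x ?I" using x nD by (simp add: sorted_slice_def)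
      have "strict_mono_on ?I x"
      proof (rule strict_mono_onI)
        fix r s assume rs: "r \<in> ?I" "s \<in> ?I" "r < s"
        then have "x r \<le> x s" using x mono_onD[of ?I x r s] by (simp add: sorted_slice_def)
        moreover have "x r \<noteq> x s" using inj_onD[OF \<open>inj_on x ?I\<close>, of r s] rs by blast
        ultimately show "x r < x s" by simp
      qed
      then show ?thesis using x by (simp add: sorted_slice_def strictly_sorted_slice_def)
    qed simp
    then have "?H (sorted_slice a ?n k) \<le> ?H (?S \<union> D)" by (intro hausdorff_measure_mono) blast
    also have "\<dots> \<le> ?H ?S + ?H D" by (rule hausdorff_measure_Un)
    also have "?H D = 0"
      using null_setsD1[OF D] null_setsD2[OF D] emeasure_surface_measure[of D ?n] by simp
    finally show "?H (sorted_slice a ?n k) \<le> ?H ?S" by simp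
  qed
  finally show ?thesis .
qed

section \<open>The volume ratio\<close>

text \<open>
  In a sorted point the bound \<open>a \<le> x\<^sub>1\<close> extends to all coordinates.
\<close>
lemma D_hat_Int_hyperplane:
  assumes "0 \<le> a" "n \<ge> 1"
  shows "D_ge n a \<inter> D_hat n \<inter> hyperplane n k = sorted_slice a n k"
proof (intro equalityI subsetI)
  fix x assume "x \<in> D_ge n a \<inter> D_hat n \<inter> hyperplane n k"
  then have x: "x \<in> {1..n} \<rightarrow>\<^sub>E {0..<1}" "a \<le> x 1" "mono_on {1..n} x" "x \<in> hyperplane n k"
    by (simp_all add: D_ge_def D_hat_def)
  have "a \<le> x i \<and> x i < 1" if i: "i \<in> {1..n}" for i
  proof -
    have "x 1 \<le> x i" using mono_onD[OF x(3), of 1 i] i assms(2) by simp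
    then show ?thesis using x(2) PiE_mem[OF x(1) i] by simp
  qed
  then show "x \<in> sorted_slice a n k" using x by (simp add: sorted_slice_def cube_slice_def)
next
  fix x assume "x \<in> sorted_slice a n k"
  then have x: "mono_on {1..n} x" "x \<in> hyperplane n k" "\<And>i. i \<in> {1..n} \<Longrightarrow> a \<le> x i \<and> x i < 1"
    by (simp_all add: sorted_slice_def cube_slice_def)
  then have "x \<in> {1..n} \<rightarrow>\<^sub>E UNIV" "(\<Sum>i=1..n. x i) \<in> \<int>"
    by (simp_all add: hyperplane_def euclid_def)
  moreover have "0 \<le> x i \<and> x i < 1" if "i \<in> {1..n}" for i using x(3)[OF that] assms(1) by simp
  ultimately show "x \<in> D_ge n a \<inter> D_hat n \<inter> hyperplane n k"
    using x(1,2) x(3)[of 1] assms(2) by (simp add: D_ge_def D_hat_def PiE_iff)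
qed

text \<open>
  One constant serves for all \<open>a\<close>: it is \<open>c / n!\<close> with \<open>c\<close> from \<open>hausdorff_over_eq_lebesgue\<close>.
\<close>
lemma vol_D_ge:
  obtains c where "0 < c" "\<And>a. 0 \<le> a \<Longrightarrow> a < 1 \<Longrightarrow>
    vol (Suc m) (D_ge (Suc m) a \<inter> D_hat (Suc m)) = c * (\<Sum>k<Suc m. irwin_hall a m (real k))"
proof -
  obtain c where c: "0 < c" "\<And>k B. B \<in> sets (lebesgue_cartesian m)
    \<Longrightarrow> hausdorff_codim1 (Suc m) (over m k B) = ennreal c * emeasure (lebesgue_cartesian m) B"
    using hausdorff_over_eq_lebesgue by blast
  have "vol (Suc m) (D_ge (Suc m) a \<inter> D_hat (Suc m))
      = c / fact (Suc m) * (\<Sum>k<Suc m. irwin_hall a m (real k))" if a: "0 \<le> a" "a < 1" for a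
  proof -
    note ih = cube_section_irwin_hall[of a m, THEN conjunct1] cube_section_irwin_hall[of a m, THEN conjunct2]
    have "hausdorff_codim1 (Suc m) (sorted_slice a (Suc m) k)
        = ennreal (c / fact (Suc m) * irwin_hall a m (real k))" for k
    proof -
      have "of_nat (fact (Suc m)) * hausdorff_codim1 (Suc m) (sorted_slice a (Suc m) k)
          = ennreal c * ennreal (irwin_hall a m (real k))"
        unfolding hausdorff_cube_slice[OF a(1), symmetric] cube_slice_eq_over
        using a by (simp only: c(2) sets_cube_section ih(1) less_imp_le)
      also have "\<dots> = of_nat (fact (Suc m)) * ennreal (c / fact (Suc m) * irwin_hall a m (real k))"
        using c(1) ih(2)[of "real k"] a
        by (simp add: ennreal_of_nat_eq_real_of_nat ennreal_mult'[symmetric] del: fact_Suc)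
      finally have "of_nat (fact (Suc m)) * hausdorff_codim1 (Suc m) (sorted_slice a (Suc m) k)
          = of_nat (fact (Suc m)) * ennreal (c / fact (Suc m) * irwin_hall a m (real k))" .
      moreover have "of_nat (fact (Suc m)) \<noteq> (0 :: ennreal)"
        by (simp only: of_nat_eq_0_iff fact_nonzero not_False_eq_True)
      moreover have "of_nat (fact (Suc m)) \<noteq> (top :: ennreal)"
        using of_nat_less_top[of "fact (Suc m)"] by (simp only: less_top)
      ultimately show ?thesis unfolding ennreal_mult_cancel_left by blast
    qed
    then have "vol (Suc m) (D_ge (Suc m) a \<inter> D_hat (Suc m))
        = enn2real (\<Sum>k<Suc m. ennreal (c / fact (Suc m) * irwin_hall a m (real k)))"
      unfolding vol_def using a by (simp only: D_hat_Int_hyperplane le_add1 Suc_eq_plus1_left diff_Suc_1)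
    also have "\<dots> = (\<Sum>k<Suc m. c / fact (Suc m) * irwin_hall a m (real k))"
    proof -
      have nonneg: "0 \<le> c / fact (Suc m) * irwin_hall a m (real k)" for k
        using c(1) ih(2) a by (intro mult_nonneg_nonneg divide_nonneg_nonneg) auto
      then show ?thesis by (simp only: sum_ennreal enn2real_ennreal sum_nonneg)
    qed
    finally show ?thesis by (simp only: sum_distrib_left)
  qed
  then show ?thesis using c(1) by (intro that[of "c / fact (Suc m)"]) auto
qed

theorem theorem1:
  fixes n :: nat and a :: real
  assumes "n \<ge> 2" and "0 \<le> a" and "a < 1"
  shows "vol n (D_ge n a \<inter> D_hat n) / vol n (D_hat n) =
    1 / fact (n - 1) *
      (\<Sum>(i, k) \<in> {(i :: nat, k :: int). 2 \<le> i \<and> i \<le> n \<and>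
            max (real i * a) (real i - real n + 1) \<le> real_of_int k \<and> k \<le> int i - 1}.
         (-1) ^ (n + i) * real (n choose i) * (real_of_int k - real i * a) ^ (n - 1))"
proof -
  obtain m where n: "n = Suc m" using assms(1) by (cases n) auto
  obtain c where c: "0 < c" "\<And>a. 0 \<le> a \<Longrightarrow> a < 1 \<Longrightarrow>
      vol n (D_ge n a \<inter> D_hat n) = c * (\<Sum>k<n. irwin_hall a m (real k))"
    using vol_D_ge[of m] unfolding n by blast
  have "D_ge n 0 \<inter> D_hat n = D_hat n"
    using assms(1) by (auto simp: D_ge_def D_hat_def PiE_iff)
  then have "vol n (D_hat n) = c" using c(2)[of 0] sum_irwin_hall_0[of m] by (simp add: n del: sum.lessThan_Suc)
  then have "vol n (D_ge n a \<inter> D_hat n) / vol n (D_hat n) = (\<Sum>k<n. irwin_hall a m (real k))"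
    using c assms by simp
  also note sum_irwin_hall[of m a, folded n]
  finally show ?thesis using assms by (simp add: n)
qed

end
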